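(* Let $p$ be a prime. Let $k\ge 1$ be an integer such that $k\not\equiv 0 \pmod{4}$ and $\mathcal{D}:=(k^2+4)/\gcd(2,k)^2$ is squarefree. Then $p$ is a $k$-Wall-Sun-Sun prime if and only if the polynomial $\mathcal{F}_p(x):=x^{2p}-kx^p-1$ is non-monogenic. Furthermore, if $p$ is a prime divisor of $k^2+4$, then $\mathcal{F}_p(x)$ is monogenic.
   Context: For an integer $k\ge 1$, let $(U_n)$ be the sequence defined by $U_0=0$, $U_1=1$ and $U_n=kU_{n-1}+U_{n-2}$ for $n\ge 2$. This sequence is periodic modulo every integer $m\ge 2$; let $\pi(m)$ denote the length of the period modulo $m$. A prime $p$ is called a $k$-Wall-Sun-Sun prime if $\pi(p^2)=\pi(p)$. A monic polynomial $f(x)\in\mathbb{Z}[x]$ of degree $N$, irreducible over $\mathbb{Q}$, is called monogenic if $\{1,\theta,\ldots,\theta^{N-1}\}$ is a basis for the ring of integers $\mathbb{Z}_K$ of $K=\mathbb{Q}(\theta)$, where $f(\theta)=0$ (equivalently $[\mathbb{Z}_K:\mathbb{Z}[\theta]]=1$), and non-monogenic otherwise. *)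

theory Defs
  imports "HOL-Computational_Algebra.Computational_Algebra" "HOL-Number_Theory.Number_Theory"
begin

fun U :: "int \<Rightarrow> nat \<Rightarrow> int" where
  "U k 0 = 0"
| "U k (Suc 0) = 1"
| "U k (Suc (Suc n)) = k * U k (Suc n) + U k n"

definition period :: "int \<Rightarrow> int \<Rightarrow> nat" where
  "period k m = (LEAST n. n > 0 \<and> (\<forall>i. [U k (i + n) = U k i] (mod m)))"

definition wall_sun_sun :: "int \<Rightarrow> nat \<Rightarrow> bool" where
  "wall_sun_sun k p \<longleftrightarrow> prime p \<and> period k (int p ^ 2) = period k (int p)"

definition num_field :: "complex \<Rightarrow> complex set" where
  "num_field \<theta> = {poly (map_poly of_rat g) \<theta> | g :: rat poly. True}"

definition ring_of_integers :: "complex \<Rightarrow> complex set" where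
  "ring_of_integers \<theta> = {\<alpha> \<in> num_field \<theta>. algebraic_int \<alpha>}"

definition monic_irred :: "int poly \<Rightarrow> bool" where
  "monic_irred f \<longleftrightarrow> lead_coeff f = 1 \<and> irreducible (map_poly (of_int :: int \<Rightarrow> rat) f)"

definition monogenic :: "int poly \<Rightarrow> bool" where
  "monogenic f \<longleftrightarrow> monic_irred f \<and>
     (\<forall>\<theta>::complex. poly (map_poly of_int f) \<theta> = 0 \<longrightarrow>
        (\<forall>c :: nat \<Rightarrow> int. (\<Sum>i<degree f. of_int (c i) * \<theta> ^ i) = 0 \<longrightarrow> (\<forall>i<degree f. c i = 0)) \<and>
        ring_of_integers \<theta> = {\<Sum>i<degree f. of_int (c i) * \<theta> ^ i | c :: nat \<Rightarrow> int. True})"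

definition non_monogenic :: "int poly \<Rightarrow> bool" where
  "non_monogenic f \<longleftrightarrow> monic_irred f \<and> \<not> monogenic f"

definition F :: "int \<Rightarrow> nat \<Rightarrow> int poly" where
  "F k p = Polynomial.monom 1 (2 * p) - Polynomial.monom k p - 1"

end

theory Submission
  imports Defs "Jordan_Normal_Form.Char_Poly"
begin

text \<open>
  Let $\theta$ be a root of \<open>F k p\<close>, so that $\alpha = \theta^p$ is a root of
  $s = x^2 - kx - 1$. The discriminant condition makes $\alpha$ a unit of $\mathbb{Q}(\alpha)$ that
  is not a $p$-th power, hence \<open>F k p\<close> is irreducible.

  The order $\mathbb{Z}[\theta]$ is maximal at each prime $q$ by Dedekind's criterion: if
  \<open>F k p\<close> equals $g^e + q M$ with $g$ squarefree modulo $q$ and $M$ invertible modulo $(g, q)$, then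
  $\mathbb{Z}[\theta]$ is maximal at $q$. One takes \<open>F k p\<close> minus $q$ for $g$ if
  $q \nmid p (k^2+4)$. If $q \mid k^2+4$, let $c$ be a root of $x^2+1$ modulo $q$ with $2c = k$
  modulo $q^2$, and take $g = x^p - c$ for $q \neq p$ and $g = x - c$ for $q = p$. The only prime at
  which the criterion can fail is an odd $p \nmid k^2+4$, with $g = s$. There
  \<open>F k p\<close> $\equiv x^p (V_p - k)$ modulo $s$, where $V$ is the companion sequence of $U$, so
  maximality at $p$ means $p^2 \nmid V_p - k$. The identity $V_p^2 - (k^2+4) U_p^2 = -4$ shows that
  $p^2 \mid V_p - k$ holds iff $\alpha^p$ is $\alpha$ or its conjugate modulo $p^2$, i.e. iff
  $p$ is a Wall-Sun-Sun prime.
\<close>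

section \<open>Two-generated ideals and the Frobenius map\<close>

text \<open>Two substitutes shape the proof. Integrality enters the maximality argument only as
  \<open>almost_integral\<close>, a common denominator for all powers: it survives the operations of
  Dedekind's criterion by binomial expansion alone. Reducedness of Z[x]/(g, q) comes not from a
  derivative or a factorisation of g modulo q but from an exponent N prime to q with x^N = 1 modulo
  (g, q). For q not dividing k^2 + 4 such an N is a period of U modulo q, since x^n = U_n x +
  U_{n-1} modulo s; so the periods behind the Wall-Sun-Sun condition also drive the criterion. If
  \<alpha> were the p-th power of some x in Q(\<alpha>), then x would have norm -1 and an integral
  trace t with V_p = k for the sequence with parameter t, whence U_p^2 (t^2 + 4) = k^2 + 4 with a
  square factor that the discriminant condition forbids. The comparison of V_p with k needs an odd p
  not dividing k^2 + 4. For the other p the Wall-Sun-Sun property is refuted by computing terms of U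
  modulo p^2.\<close>

definition ideal2 :: "'a::comm_ring_1 \<Rightarrow> 'a \<Rightarrow> 'a set" where
  "ideal2 a b = {a * u + b * v | u v. True}"

lemma ideal2I: "x = a * u + b * v \<Longrightarrow> x \<in> ideal2 a b"
  unfolding ideal2_def by blast

lemma ideal2E:
  assumes "x \<in> ideal2 a b"
  obtains u v where "x = a * u + b * v"
  using assms unfolding ideal2_def by blast

lemma ideal2_mult: "x \<in> ideal2 a b \<Longrightarrow> x * y \<in> ideal2 a b"
proof (elim ideal2E)
  fix u v assume "x = a * u + b * v"
  then show ?thesis by (intro ideal2I[of _ _ "u * y" _ "v * y"]) (simp add: algebra_simps)
qed

lemma ideal2_dvd: "x \<in> ideal2 a b \<Longrightarrow> x dvd y \<Longrightarrow> y \<in> ideal2 a b"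
  by (auto simp: dvd_def intro: ideal2_mult)

lemma ideal2_add: "x \<in> ideal2 a b \<Longrightarrow> y \<in> ideal2 a b \<Longrightarrow> x + y \<in> ideal2 a b"
proof (elim ideal2E)
  fix u v u' v' assume "x = a * u + b * v" "y = a * u' + b * v'"
  then show ?thesis by (intro ideal2I[of _ _ "u + u'" _ "v + v'"]) (simp add: algebra_simps)
qed

lemma ideal2_uminus: "x \<in> ideal2 a b \<Longrightarrow> - x \<in> ideal2 a b"
  using ideal2_mult[of x a b "-1"] by simp

lemma ideal2_diff: "x \<in> ideal2 a b \<Longrightarrow> y \<in> ideal2 a b \<Longrightarrow> x - y \<in> ideal2 a b"
  using ideal2_add[OF _ ideal2_uminus] by fastforce

lemma ideal2_generators: "a \<in> ideal2 a b" "b \<in> ideal2 a b"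
  by (rule ideal2I[of _ _ 1 _ 0], simp, rule ideal2I[of _ _ 0 _ 1], simp)

lemma ideal2_dvd_left: "a dvd x \<Longrightarrow> x \<in> ideal2 a b"
  and ideal2_dvd_right: "b dvd x \<Longrightarrow> x \<in> ideal2 a b"
  using ideal2_dvd ideal2_generators by blast+

lemma ideal2_diff_trans:
  "x - y \<in> ideal2 a b \<Longrightarrow> y - z \<in> ideal2 a b \<Longrightarrow> x - z \<in> ideal2 a b"
  using ideal2_add[of "x - y" a b "y - z"] by simp

lemma ideal2_diff_mem: "x - y \<in> ideal2 a b \<Longrightarrow> y \<in> ideal2 a b \<Longrightarrow> x \<in> ideal2 a b"
  using ideal2_add[of "x - y" a b y] by simp

lemma diff_dvd_power_diff: "x - y dvd x ^ n - (y ^ n :: 'a::comm_ring_1)"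
  by (cases n) (simp_all add: diff_power_eq_sum del: power_Suc)

lemma ideal2_power_diff: "x - y \<in> ideal2 a b \<Longrightarrow> x ^ n - y ^ n \<in> ideal2 a b"
  using ideal2_dvd diff_dvd_power_diff by blast

lemma prime_dvd_power_add:
  fixes a b :: "'a::comm_ring_1"
  assumes "prime p"
  shows "of_nat p dvd (a + b) ^ p - (a ^ p + b ^ p)"
proof -
  have "p > 0" using assms by (simp add: prime_gt_0_nat)
  have "(a + b) ^ p = (\<Sum>k\<le>p. of_nat (p choose k) * a ^ k * b ^ (p - k))"
    by (rule binomial_ring)
  also have "{..p} = insert 0 (insert p {0<..<p})" using \<open>p > 0\<close> by auto
  also have "(\<Sum>k\<in>insert 0 (insert p {0<..<p}). of_nat (p choose k) * a ^ k * b ^ (p - k))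
      = b ^ p + (a ^ p + (\<Sum>k\<in>{0<..<p}. of_nat (p choose k) * a ^ k * b ^ (p - k)))"
    using \<open>p > 0\<close> by simp
  finally have "(a + b) ^ p - (a ^ p + b ^ p) = (\<Sum>k\<in>{0<..<p}. of_nat (p choose k) * a ^ k * b ^ (p - k))"
    by simp
  moreover have "of_nat p dvd (of_nat (p choose k) :: 'a)" if "k \<in> {0<..<p}" for k
    using dvd_choose_prime[of k p] that assms by (auto elim!: dvdE)
  ultimately show ?thesis by (auto intro!: dvd_sum dvd_mult2)
qed

lemma fermat_int:
  assumes "prime p"
  shows "int p dvd a ^ p - a"
proof -
  have nat: "int p dvd int n ^ p - int n" for n
  proof (induction n)
    case 0
    then show ?case using assms by (simp add: power_0_left prime_gt_0_nat)
  next
    case (Suc n)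
    have "int p dvd (int n + 1) ^ p - (int n ^ p + 1 ^ p) + (int n ^ p - int n)"
      using prime_dvd_power_add[OF assms, of "int n" 1] Suc by (intro dvd_add) auto
    then show ?case by (simp add: algebra_simps)
  qed
  define r where "r = nat (a mod int p)"
  have r: "[a = int r] (mod int p)" using assms by (simp add: r_def prime_gt_0_nat cong_def)
  have "[a ^ p - a = int r ^ p - int r] (mod int p)" by (intro cong_diff cong_pow r)
  then show ?thesis using nat[of r] cong_dvd_iff by blast
qed

text \<open>Raising to the power p is additive modulo p and fixes constants by Fermat, so writing g
  as a + x g' reduces the claim to g'.\<close>

lemma frobenius_int_poly:
  assumes "prime p"
  shows "of_nat p dvd g ^ p - pcompose g ([:0, 1:] ^ p :: int poly)"
proof (induction g)
  case 0
  then show ?case using assms by (simp add: power_0_left prime_gt_0_nat)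
next
  case (pCons a g)
  define X :: "int poly" where "X = [:0, 1:]"
  have 1: "pCons a g = [:a:] + X * g" by (simp add: X_def)
  have "[:a:] ^ p - [:a:] = [:a ^ p - a:]" by (simp add: poly_const_pow)
  moreover have "of_nat p dvd [:a ^ p - a:]"
    using fermat_int[OF assms, of a] by (simp add: of_nat_poly const_poly_dvd)
  ultimately have 2: "of_nat p dvd [:a:] ^ p - [:a:]" by simp
  have 3: "of_nat p dvd ([:a:] + X * g) ^ p - ([:a:] ^ p + (X * g) ^ p)"
    by (rule prime_dvd_power_add[OF assms])
  have eq: "(pCons a g) ^ p - pcompose (pCons a g) (X ^ p)
    = (([:a:] + X * g) ^ p - ([:a:] ^ p + (X * g) ^ p)) + ([:a:] ^ p - [:a:])
       + X ^ p * (g ^ p - pcompose g (X ^ p))"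
    unfolding pcompose_pCons unfolding 1 by (simp add: algebra_simps power_mult_distrib)
  show ?case unfolding X_def[symmetric] eq
    by (intro dvd_add 2 3 dvd_mult pCons.IH[folded X_def])
qed

lemma frobenius_int_poly_iterated:
  assumes "prime p"
  shows "of_nat p dvd g ^ (p ^ m) - pcompose g ([:0, 1:] ^ (p ^ m) :: int poly)"
proof (induction m)
  case (Suc m)
  let ?X = "[:0, 1:] :: int poly"
  let ?h = "pcompose g (?X ^ (p ^ m))"
  have "of_nat p dvd (g ^ (p ^ m)) ^ p - ?h ^ p"
    using Suc diff_dvd_power_diff dvd_trans by blast
  moreover have "of_nat p dvd ?h ^ p - pcompose ?h (?X ^ p)"
    by (rule frobenius_int_poly[OF assms])
  ultimately have "of_nat p dvd ((g ^ (p ^ m)) ^ p - ?h ^ p) + (?h ^ p - pcompose ?h (?X ^ p))"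
    by (rule dvd_add)
  moreover have "pcompose ?h (?X ^ p) = pcompose g (?X ^ (p ^ Suc m))"
  proof -
    have "pcompose (?X ^ n) h = h ^ n" for n and h :: "int poly"
      by (induction n) (simp_all add: pcompose_mult pcompose_pCons pcompose_1)
    then show ?thesis by (simp add: power_mult mult.commute flip: pcompose_assoc)
  qed
  moreover have "(g ^ (p ^ m)) ^ p = g ^ (p ^ Suc m)"
    by (simp add: mult.commute flip: power_mult)
  ultimately show ?case by simp
qed simp

lemma diff_dvd_pcompose_diff: "a - b dvd pcompose g a - pcompose (g :: 'a::comm_ring_1 poly) b"
proof (induction g)
  case (pCons c g)
  have "pcompose (pCons c g) a - pcompose (pCons c g) b
    = a * (pcompose g a - pcompose g b) + (a - b) * pcompose g b"
    by (simp add: pcompose_pCons algebra_simps)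
  then show ?case using pCons.IH by simp
qed simp

text \<open>If $x$ has finite order prime to $q$ modulo $(s, q)$, then some power of the Frobenius map
  is the identity on $\mathbb{Z}[x]/(s, q)$, so this ring is reduced.\<close>
lemma ideal2_radical:
  fixes s :: "int poly"
  assumes q: "prime q" and N: "\<not> q dvd N" and ord: "[:0, 1:] ^ N - 1 \<in> ideal2 s (of_nat q)"
    and g: "g ^ n \<in> ideal2 s (of_nat q)"
  shows "g \<in> ideal2 s (of_nat q)"
proof -
  let ?X = "[:0, 1:] :: int poly" and ?I = "ideal2 s (of_nat q)"
  have "coprime q N" using q N by (simp add: prime_imp_coprime)
  \<comment> \<open>The extra factor \<open>n\<close> in the exponent makes \<open>Q\<close> at
    least \<open>n\<close>, so that \<open>g ^ Q\<close> lies in the ideal, while \<open>Q\<close>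
    stays 1 modulo \<open>N\<close>, so that \<open>X ^ Q\<close> agrees with
    \<open>X\<close>.\<close>
  then have "[(q ^ totient N) ^ n = 1 ^ n] (mod N)" by (intro cong_pow euler_theorem)
  then have "[q ^ (totient N * n) = 1] (mod N)" by (simp add: power_mult)
  moreover define Q where "Q = q ^ (totient N * n)"
  moreover have "Q \<ge> 1" using q by (simp add: Q_def Suc_le_eq prime_gt_0_nat)
  ultimately obtain j where j: "Q = N * j + 1"
    by (metis cong_to_1_nat dvdE le_add_diff_inverse2)
  have "N > 0" using N by (cases N) auto
  then have "n \<le> totient N * n" using mult_le_mono1[of 1 "totient N" n] by (simp add: Suc_le_eq)
  also have "\<dots> \<le> Q" unfolding Q_def using prime_ge_2_nat[OF q]
    by (intro less_imp_le power_gt_expt) simp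
  finally have "g ^ Q \<in> ?I" using ideal2_dvd[OF g] le_imp_power_dvd by blast
  moreover have "g ^ Q - pcompose g (?X ^ Q) \<in> ?I"
    unfolding Q_def by (intro ideal2_dvd_right frobenius_int_poly_iterated q)
  ultimately have 1: "pcompose g (?X ^ Q) \<in> ?I"
    using ideal2_diff by fastforce
  have "?X ^ Q - ?X = ((?X ^ N) ^ j - 1 ^ j) * ?X"
    by (simp add: j power_mult algebra_simps)
  then have "?X ^ Q - ?X \<in> ?I"
    using ideal2_mult[OF ideal2_power_diff[OF ord]] by metis
  then have 2: "pcompose g (?X ^ Q) - pcompose g ?X \<in> ?I"
    using ideal2_dvd diff_dvd_pcompose_diff by blast
  from ideal2_diff[OF 1 2] show ?thesis by simp
qed

section \<open>Integral elements and Dedekind's criterion\<close>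

text \<open>\<open>range (ev \<theta>)\<close> is the order Z[\<theta>], treated throughout as a set
  of complex numbers.\<close>

definition ev :: "complex \<Rightarrow> int poly \<Rightarrow> complex" where
  "ev \<theta> h = poly (map_poly of_int h) \<theta>"

lemma ev_simps [simp]:
  "ev \<theta> (g + h) = ev \<theta> g + ev \<theta> h" "ev \<theta> (g - h) = ev \<theta> g - ev \<theta> h"
  "ev \<theta> (- h) = - ev \<theta> h"
  "ev \<theta> (g * h) = ev \<theta> g * ev \<theta> h" "ev \<theta> (h ^ n) = ev \<theta> h ^ n"
  "ev \<theta> (of_nat n) = of_nat n" "ev \<theta> (numeral w) = numeral w" "ev \<theta> [:c:] = of_int c"
  "ev \<theta> 0 = 0" "ev \<theta> 1 = 1" "ev \<theta> [:0, 1:] = \<theta>"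
  "ev \<theta> (Polynomial.smult c h) = of_int c * ev \<theta> h"
  by (simp_all add: ev_def hom_distribs of_nat_poly)

lemma ev_eq_sum: "degree h < n \<Longrightarrow> ev \<theta> h = (\<Sum>i<n. of_int (Polynomial.coeff h i) * \<theta> ^ i)"
  unfolding ev_def poly_altdef of_int_hom.degree_map_poly_hom of_int_hom.coeff_map_poly_hom
  by (intro sum.mono_neutral_left) (auto simp: coeff_eq_0)

lemma ev_sum: "ev \<theta> (sum h A) = (\<Sum>i\<in>A. ev \<theta> (h i))"
  by (induction A rule: infinite_finite_induct) auto

text \<open>This is membership in the complete integral closure of Z[\<theta>]: one denominator
  \<open>d\<close> serves all powers of \<beta>.\<close>

definition almost_integral :: "complex \<Rightarrow> complex \<Rightarrow> bool" where
  "almost_integral \<theta> \<beta> \<longleftrightarrow> (\<exists>d::nat. d > 0 \<and> (\<forall>m. of_nat d * \<beta> ^ m \<in> range (ev \<theta>)))"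

lemma ev_range_add: "x \<in> range (ev \<theta>) \<Longrightarrow> y \<in> range (ev \<theta>) \<Longrightarrow> x + y \<in> range (ev \<theta>)"
  by (auto simp flip: ev_simps(1))

lemma ev_range_mult: "x \<in> range (ev \<theta>) \<Longrightarrow> y \<in> range (ev \<theta>) \<Longrightarrow> x * y \<in> range (ev \<theta>)"
  by (auto simp flip: ev_simps(4))

lemma ev_range_power: "x \<in> range (ev \<theta>) \<Longrightarrow> x ^ n \<in> range (ev \<theta>)"
  by (auto simp flip: ev_simps(5))

lemma ev_range_of_int: "of_int c \<in> range (ev \<theta>)"
  using rangeI[of "ev \<theta>" "[:c:]"] by simp

lemma ev_range_of_nat: "of_nat c \<in> range (ev \<theta>)"
  using rangeI[of "ev \<theta>" "of_nat c"] by simp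

lemma ev_range_sum: "(\<And>i. i \<in> A \<Longrightarrow> x i \<in> range (ev \<theta>)) \<Longrightarrow> sum x A \<in> range (ev \<theta>)"
proof (induction A rule: infinite_finite_induct)
  case (insert a A)
  then show ?case by (auto intro: ev_range_add)
qed (use ev_range_of_nat[of 0] in auto)

lemma almost_integral_add_ev:
  assumes "almost_integral \<theta> \<beta>" "r \<in> range (ev \<theta>)"
  shows "almost_integral \<theta> (\<beta> + r)"
proof -
  obtain d where d: "d > 0" "\<And>m. of_nat d * \<beta> ^ m \<in> range (ev \<theta>)"
    using assms(1) unfolding almost_integral_def by blast
  have "of_nat d * (\<beta> + r) ^ m \<in> range (ev \<theta>)" for m
  proof -
    have "of_nat d * (\<beta> + r) ^ m = (\<Sum>k\<le>m. of_nat (m choose k) * (of_nat d * \<beta> ^ k) * r ^ (m - k))"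
      unfolding binomial_ring sum_distrib_left by (simp add: mult_ac)
    also have "\<dots> \<in> range (ev \<theta>)"
      by (intro ev_range_sum ev_range_mult ev_range_of_nat ev_range_power d assms(2))
    finally show ?thesis .
  qed
  then show ?thesis using d(1) unfolding almost_integral_def by blast
qed

lemma almost_integral_mult_ev:
  assumes "almost_integral \<theta> \<beta>" "r \<in> range (ev \<theta>)"
  shows "almost_integral \<theta> (\<beta> * r)"
proof -
  obtain d where d: "d > 0" "\<And>m. of_nat d * \<beta> ^ m \<in> range (ev \<theta>)"
    using assms(1) unfolding almost_integral_def by blast
  have "of_nat d * (\<beta> * r) ^ m \<in> range (ev \<theta>)" for m
    using ev_range_mult[OF d(2)[of m] ev_range_power[OF assms(2), of m]]
    by (simp add: power_mult_distrib mult_ac)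
  then show ?thesis using d(1) unfolding almost_integral_def by blast
qed

lemma almost_integral_power:
  assumes "almost_integral \<theta> \<beta>"
  shows "almost_integral \<theta> (\<beta> ^ e)"
  using assms unfolding almost_integral_def by (metis power_mult)

text \<open>If \<beta> is a root of a monic polynomial of degree n, then c^n clears the powers below
  n, and the monic relation expresses every higher power by lower ones with integer coefficients, so
  the same c^n works for all.\<close>

lemma algebraic_int_imp_almost_integral:
  assumes "algebraic_int \<beta>" "c > 0" "of_nat c * \<beta> = ev \<theta> g"
  shows "almost_integral \<theta> \<beta>"
proof -
  obtain P :: "int poly" where P: "lead_coeff P = 1" "ev \<beta> P = 0"
    using assms(1) unfolding algebraic_int_altdef_ipoly ev_def by blast
  define n where "n = degree P"
  have ev_P: "ev \<beta> P = (\<Sum>i<n. of_int (Polynomial.coeff P i) * \<beta> ^ i) + \<beta> ^ n"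
    using ev_eq_sum[of P "Suc n" \<beta>] P(1) by (simp add: n_def)
  have rec: "\<beta> ^ n = - (\<Sum>i<n. of_int (Polynomial.coeff P i) * \<beta> ^ i)"
    using P(2) unfolding ev_P by (simp add: eq_neg_iff_add_eq_0 add.commute)
  have "of_nat (c ^ n) * \<beta> ^ m \<in> range (ev \<theta>)" for m
  proof (induction m rule: less_induct)
    case (less m)
    show ?case
    proof (cases "m < n")
      case True
      have "of_nat (c ^ n) * \<beta> ^ m = of_nat (c ^ (n - m)) * (of_nat c * \<beta>) ^ m"
        using True by (simp add: power_mult_distrib flip: power_add)
      also have "\<dots> \<in> range (ev \<theta>)"
        unfolding assms(3) by (intro ev_range_mult ev_range_of_nat ev_range_power) simp
      finally show ?thesis .
    next
      case False
      then have "\<beta> ^ m = \<beta> ^ (m - n) * \<beta> ^ n" by (simp flip: power_add)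
      then have "of_nat (c ^ n) * \<beta> ^ m
        = (\<Sum>i<n. of_int (- Polynomial.coeff P i) * (of_nat (c ^ n) * \<beta> ^ (m - n + i)))"
        unfolding rec by (simp add: sum_distrib_left sum_negf power_add mult_ac)
      also have "\<dots> \<in> range (ev \<theta>)"
        using False by (intro ev_range_sum ev_range_mult ev_range_of_int less) auto
      finally show ?thesis .
    qed
  qed
  moreover have "c ^ n > 0" using assms(2) by simp
  ultimately show ?thesis unfolding almost_integral_def by blast
qed

text \<open>\<open>f\<close> generates the kernel of evaluation, which identifies Z[\<theta>] with
  Z[x]/(f) and turns equations in \<theta> into divisibility of polynomials.\<close>

locale monic_annihilator =
  fixes \<theta> :: complex and f :: "int poly"
  assumes ev_eq_0_iff: "ev \<theta> h = 0 \<longleftrightarrow> f dvd h"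
begin

text \<open>Write the common denominator as d = q^a d' with d' prime to q. The power a + 1 exceeds
  the q-part by one, so d' g^(a+1) lies in (f, q), and d' is invertible modulo q.\<close>

lemma almost_integral_nilpotent:
  assumes q: "prime q" and g: "almost_integral \<theta> (ev \<theta> g / of_nat q)"
  obtains m where "g ^ m \<in> ideal2 f (of_nat q)"
proof -
  obtain d where d: "d > 0" "\<And>m. of_nat d * (ev \<theta> g / of_nat q) ^ m \<in> range (ev \<theta>)"
    using g unfolding almost_integral_def by blast
  have q0: "q > 0" using q by (rule prime_gt_0_nat)
  have "\<not> is_unit q" "d \<noteq> 0" using q d(1) by auto
  then obtain a d' where d': "d = q ^ a * d'" "\<not> q dvd d'"
    using multiplicity_decompose'[of d q] by blast
  let ?m = "Suc a"
  obtain h where h: "of_nat d * (ev \<theta> g / of_nat q) ^ ?m = ev \<theta> h" using d(2) by blast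
  have "of_nat d * ev \<theta> g ^ ?m = of_nat (q ^ ?m) * ev \<theta> h"
    unfolding h[symmetric] using q0 by (simp add: field_simps)
  then have "of_nat (q ^ a) * (of_nat d' * ev \<theta> g ^ ?m) = of_nat (q ^ a) * (of_nat q * ev \<theta> h)"
    by (simp add: d' mult_ac)
  then have "of_nat d' * ev \<theta> g ^ ?m = of_nat q * ev \<theta> h"
    using q0 by (subst (asm) mult_left_cancel) auto
  then have "ev \<theta> (of_nat d' * g ^ ?m - of_nat q * h) = 0" by simp
  then have "f dvd of_nat d' * g ^ ?m - of_nat q * h" using ev_eq_0_iff by blast
  then have dg: "of_nat d' * g ^ ?m \<in> ideal2 f (of_nat q)"
    using ideal2_diff_mem ideal2_dvd_left ideal2_dvd_right by (metis dvd_triv_left)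
  have "coprime (int d') (int q)" using prime_imp_coprime[OF q d'(2)] by (simp add: coprime_commute)
  then obtain x y where xy: "x * int d' + y * int q = 1"
    using bezout_int[of "int d'" "int q"] by auto
  have one: "[:x:] * of_nat d' + [:y:] * of_nat q = (1 :: int poly)"
    using xy by (simp add: of_nat_poly mult_ac one_pCons)
  have "g ^ ?m = ([:x:] * of_nat d' + [:y:] * of_nat q) * g ^ ?m" unfolding one by simp
  also have "\<dots> = [:x:] * (of_nat d' * g ^ ?m) + of_nat q * ([:y:] * g ^ ?m)"
    by (simp only: distrib_left distrib_right mult_ac)
  also have "\<dots> \<in> ideal2 f (of_nat q)"
    by (rule ideal2_add[OF ideal2_dvd[OF dg dvd_triv_right] ideal2_dvd_right[OF dvd_triv_left]])
  finally show ?thesis using that by blast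
qed

text \<open>One direction of Dedekind's criterion: powers of $s$ are stripped off the numerator one at a
  time, since $s^e \equiv -q M$ with $M$ invertible modulo $(s, q)$.\<close>
lemma dedekind_maximal:
  assumes q: "prime q" and f: "f = s ^ e + of_nat q * M"
    and M: "b * M - 1 \<in> ideal2 s (of_nat q)"
    and rad: "\<And>g n. g ^ n \<in> ideal2 s (of_nat q) \<Longrightarrow> g \<in> ideal2 s (of_nat q)"
    and e: "e > 0" and g: "almost_integral \<theta> (ev \<theta> g / of_nat q)"
  shows "ev \<theta> g / of_nat q \<in> range (ev \<theta>)"
proof -
  let ?q = "of_nat q :: int poly" and ?I = "ideal2 s (of_nat q)"
  have q0: "(of_nat q :: complex) \<noteq> 0" using q by auto
  have f_I: "x \<in> ?I" if "x \<in> ideal2 f ?q" for x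
  proof -
    from that obtain u v where "x = f * u + ?q * v" by (rule ideal2E)
    then have "x = s * (s ^ (e - 1) * u) + ?q * (M * u + v)"
      using e unfolding f by (cases e) (simp_all add: algebra_simps)
    then show ?thesis by (rule ideal2I)
  qed
  have nil: "x \<in> ?I" if int: "almost_integral \<theta> (ev \<theta> x / of_nat q)" for x
  proof -
    obtain m where "x ^ m \<in> ideal2 f ?q" by (rule almost_integral_nilpotent[OF q int])
    from rad[OF f_I[OF this]] show ?thesis .
  qed
  have f0: "ev \<theta> f = 0" using ev_eq_0_iff by simp
  then have sM: "ev \<theta> s ^ e = of_nat q * (- ev \<theta> M)"
    unfolding f by (simp add: eq_neg_iff_add_eq_0)
  have "\<exists>h r. g = s ^ j * h + ?q * r" if "j \<le> e" for j
    using that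
  proof (induction j)
    case 0
    show ?case by (rule exI[of _ g], rule exI[of _ 0]) simp
  next
    case (Suc j)
    then obtain h r where hr: "g = s ^ j * h + ?q * r" by auto
    have je: "j < e" using Suc by simp
    have eq: "ev \<theta> (s ^ j * h) / of_nat q = ev \<theta> g / of_nat q + ev \<theta> (- r)"
      using q0 unfolding hr by (simp add: field_simps)
    have "almost_integral \<theta> (ev \<theta> (s ^ j * h) / of_nat q)"
      unfolding eq by (intro almost_integral_add_ev g rangeI)
    \<comment> \<open>The e-th power turns s^j into (s^e)^j = (-q M)^j and leaves the denominator
      q^(e-j). The factor q^(e-j-1) reduces it to a single q, the form that \<open>nil\<close>
      accepts.\<close>
    then have "almost_integral \<theta> ((ev \<theta> (s ^ j * h) / of_nat q) ^ e * ev \<theta> (?q ^ (e - j - 1)))"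
      by (intro almost_integral_mult_ev almost_integral_power rangeI)
    also have "(ev \<theta> (s ^ j * h) / of_nat q) ^ e * ev \<theta> (?q ^ (e - j - 1))
      = (ev \<theta> s ^ e) ^ j * ev \<theta> h ^ e / of_nat q ^ e * of_nat q ^ (e - j - 1)"
    proof -
      have "(ev \<theta> s ^ j) ^ e = (ev \<theta> s ^ e) ^ j" by (simp only: mult.commute flip: power_mult)
      then show ?thesis by (simp add: power_divide power_mult_distrib)
    qed
    also have "\<dots> = (- ev \<theta> M) ^ j * ev \<theta> h ^ e * (of_nat q ^ j * of_nat q ^ (e - j - 1) / of_nat q ^ e)"
      unfolding sM power_mult_distrib by (simp add: mult_ac)
    also have "of_nat q ^ j * of_nat q ^ (e - j - 1) / of_nat q ^ e = (1 / of_nat q :: complex)"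
    proof -
      have "e = Suc (j + (e - j - 1))" using je by simp
      then have "(of_nat q :: complex) ^ e = of_nat q * (of_nat q ^ j * of_nat q ^ (e - j - 1))"
        by (metis power_Suc power_add)
      then show ?thesis using q0 by (simp add: field_simps)
    qed
    finally have "almost_integral \<theta> (ev \<theta> ((- M) ^ j * h ^ e) / of_nat q)" by simp
    then have mem: "(- M) ^ j * h ^ e \<in> ?I" by (rule nil)
    have "(- b) ^ j * (- M) ^ j - 1 ^ j \<in> ?I"
      using ideal2_power_diff[OF M, of j] by (simp flip: power_mult_distrib)
    then have "h ^ e * ((- b) ^ j * (- M) ^ j - 1) \<in> ?I"
      using ideal2_mult by (metis mult.commute power_one)
    then have "(- b) ^ j * ((- M) ^ j * h ^ e) - h ^ e \<in> ?I" by (simp add: algebra_simps)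
    moreover have "(- b) ^ j * ((- M) ^ j * h ^ e) \<in> ?I"
      using ideal2_dvd[OF mem] by simp
    ultimately have "h ^ e \<in> ?I" using ideal2_diff by fastforce
    then have "h \<in> ?I" by (rule rad)
    then obtain u v where "h = s * u + ?q * v" by (rule ideal2E)
    then have "g = s ^ Suc j * u + ?q * (s ^ j * v + r)" unfolding hr by (simp add: algebra_simps)
    then show ?case by blast
  qed
  \<comment> \<open>At j = e the remaining power s^e is itself a multiple of q in Z[\<theta>], so
    g(\<theta>) is divisible by q.\<close>
  then obtain h r where "g = s ^ e * h + ?q * r" by blast
  then have "ev \<theta> g = of_nat q * ev \<theta> (r - M * h)" by (simp add: sM algebra_simps)
  then have eq: "ev \<theta> g / of_nat q = ev \<theta> (r - M * h)"
    by (simp only: nonzero_mult_div_cancel_left[OF q0])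
  show ?thesis unfolding eq by (rule rangeI)
qed

text \<open>Local maximality becomes global by removing one prime q at a time from the denominator N
  = q N': the number N' \<beta> has denominator q only, hence lies in Z[\<theta>].\<close>

lemma saturated:
  assumes max: "\<And>q g. prime q \<Longrightarrow> almost_integral \<theta> (ev \<theta> g / of_nat q) \<Longrightarrow>
      ev \<theta> g / of_nat q \<in> range (ev \<theta>)"
    and "N > 0" "of_nat N * \<beta> \<in> range (ev \<theta>)" "almost_integral \<theta> \<beta>"
  shows "\<beta> \<in> range (ev \<theta>)"
  using assms(2-)
proof (induction N rule: less_induct)
  case (less N)
  show ?case
  proof (cases "N = 1")
    case True
    then show ?thesis using less by simp
  next
    case False
    then obtain q where q: "prime q" "q dvd N" using prime_factor_nat by blast
    then obtain N' where N': "N = q * N'" by blast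
    obtain g where g: "of_nat N * \<beta> = ev \<theta> g" using less.prems by blast
    have eq: "of_nat N' * \<beta> = ev \<theta> g / of_nat q"
      using q(1) unfolding g[symmetric] N' by (simp add: field_simps)
    have "almost_integral \<theta> (\<beta> * of_nat N')"
      by (intro almost_integral_mult_ev less.prems ev_range_of_nat)
    then have "of_nat N' * \<beta> \<in> range (ev \<theta>)"
      unfolding eq[symmetric] using max[OF q(1)] eq by (simp add: mult.commute)
    moreover have "N' < N" "N' > 0"
      using less.prems(1) prime_gt_1_nat[OF q(1)] unfolding N' by auto
    ultimately show ?thesis using less by blast
  qed
qed

end

section \<open>Integrality through finite modules, and Z[\<theta>] as ring of integers\<close>

lemma monic_int_poly_division:
  fixes f g :: "int poly"
  assumes "lead_coeff f = 1" "degree f > 0"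
  obtains u r where "g = f * u + r" "degree r < degree f"
proof -
  obtain u r where ur: "pseudo_divmod g f = (u, r)" by fastforce
  have "f \<noteq> 0" using assms by auto
  from pseudo_divmod[OF this ur] show ?thesis using that[of u r] assms by auto
qed

text \<open>Determinant trick: multiplication by x acts on the nonzero vector v through an integer
  matrix, so x is an eigenvalue and a root of its monic characteristic polynomial. The free index
  type admits the pairs used for quadratic extensions of Z[\<theta>].\<close>

lemma algebraic_int_finite_module:
  fixes v :: "'i \<Rightarrow> complex"
  assumes I: "finite I" and nz: "\<exists>i\<in>I. v i \<noteq> 0"
    and mult: "\<And>i. i \<in> I \<Longrightarrow> \<exists>c::'i \<Rightarrow> int. x * v i = (\<Sum>j\<in>I. of_int (c j) * v j)"
  shows "algebraic_int x"
proof -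
  define n where "n = card I"
  obtain h where h: "bij_betw h {..<n} I"
    using ex_bij_betw_nat_finite[OF I] by (auto simp: n_def atLeast0LessThan)
  obtain c where c: "\<And>i. i \<in> I \<Longrightarrow> x * v i = (\<Sum>j\<in>I. of_int (c i j :: int) * v j)"
    using bchoice[of I "\<lambda>i c. x * v i = (\<Sum>j\<in>I. of_int (c j) * v j)"] mult by auto
  define A where "A = mat n n (\<lambda>(i, j). c (h i) (h j))"
  define w where "w = vec n (\<lambda>i. v (h i))"
  let ?A = "map_mat of_int A :: complex mat"
  have A: "A \<in> carrier_mat n n" by (simp add: A_def)
  then have A': "?A \<in> carrier_mat n n" by simp
  have hI: "h i \<in> I" if "i < n" for i using h that by (auto simp: bij_betw_def)
  have "w \<noteq> 0\<^sub>v n"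
  proof
    assume "w = 0\<^sub>v n"
    then have "v (h i) = 0" if "i < n" for i using that by (metis index_vec index_zero_vec(1) w_def)
    moreover obtain i where "i \<in> I" "v i \<noteq> 0" using nz by blast
    moreover have "I = h ` {..<n}" using h by (simp add: bij_betw_def)
    ultimately show False by auto
  qed
  moreover have "?A *\<^sub>v w = x \<cdot>\<^sub>v w"
  proof (rule eq_vecI)
    fix i assume "i < dim_vec (x \<cdot>\<^sub>v w)"
    then have i: "i < n" by (simp add: w_def)
    have "(?A *\<^sub>v w) $ i = (\<Sum>j<n. of_int (c (h i) (h j)) * v (h j))"
      using i by (simp add: A_def w_def scalar_prod_def atLeast0LessThan)
    also have "\<dots> = (\<Sum>j\<in>I. of_int (c (h i) j) * v j)"
      by (rule sum.reindex_bij_betw[OF h])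
    also have "\<dots> = x * v (h i)" using c hI[OF i] by simp
    finally show "(?A *\<^sub>v w) $ i = (x \<cdot>\<^sub>v w) $ i" using i by (simp add: w_def)
  qed (simp add: A_def w_def)
  moreover have "w \<in> carrier_vec n" by (simp add: w_def)
  ultimately have "eigenvalue ?A x"
    using A' unfolding eigenvalue_def eigenvector_def by auto
  then have "poly (char_poly ?A) x = 0" using eigenvalue_root_char_poly[OF A'] by simp
  then have "poly (map_poly of_int (char_poly A)) x = 0"
    by (simp add: of_int_hom.char_poly_hom[OF A])
  moreover have "lead_coeff (char_poly A) = 1" using degree_monic_char_poly[OF A] by simp
  ultimately show ?thesis unfolding algebraic_int_altdef_ipoly by blast
qed

lemma rat_poly_clear_denominator:
  obtains N :: nat and h :: "int poly"
  where "N > 0" "Polynomial.smult (of_nat N) g = map_poly rat_of_int h"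
proof -
  have "\<exists>N h. N > 0 \<and> Polynomial.smult (of_nat N) g = map_poly rat_of_int h"
  proof (induction g)
    case 0
    show ?case by (rule exI[of _ 1], rule exI[of _ 0]) simp
  next
    case (pCons a g)
    then obtain N h where N: "N > 0" "Polynomial.smult (of_nat N) g = map_poly rat_of_int h" by blast
    obtain m d where "quotient_of a = (m, d)" by fastforce
    then have md: "a = of_int m / of_int d" "d > 0"
      by (rule quotient_of_div, rule quotient_of_denom_pos)
    have "Polynomial.smult (of_nat (N * nat d)) (pCons a g) = map_poly rat_of_int (pCons (of_nat N * m) (Polynomial.smult d h))"
      using md N(2) by (simp add: hom_distribs mult.commute flip: N(2) smult_smult)
    moreover have "N * nat d > 0" using N md by simp
    ultimately show ?case by blast
  qed
  then show ?thesis using that by blast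
qed

lemma num_field_clear_denominator:
  assumes "\<beta> \<in> num_field \<theta>"
  obtains N where "N > 0" "of_nat N * \<beta> \<in> range (ev \<theta>)"
proof -
  obtain g where g: "\<beta> = poly (map_poly of_rat g) \<theta>" using assms unfolding num_field_def by blast
  obtain N h where N: "N > 0" "Polynomial.smult (of_nat N) g = map_poly rat_of_int h"
    by (rule rat_poly_clear_denominator)
  have "of_nat N * \<beta> = poly (map_poly of_rat (Polynomial.smult (of_nat N) g)) \<theta>"
    by (simp add: g hom_distribs)
  also have "\<dots> = ev \<theta> h" unfolding N(2) ev_def by (simp add: map_poly_map_poly o_def)
  finally show ?thesis using that N(1) by blast
qed

locale monogenic_order = monic_annihilator +
  assumes monic: "lead_coeff f = 1" and degree_pos: "degree f > 0"
begin

lemma ev_reduce: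
  obtains r where "degree r < degree f" "ev \<theta> h = ev \<theta> r"
proof -
  obtain u r where "h = f * u + r" "degree r < degree f"
    by (rule monic_int_poly_division[OF monic degree_pos])
  moreover have "ev \<theta> f = 0" using ev_eq_0_iff by simp
  ultimately show ?thesis using that by simp
qed

lemma ev_eq_power_sum: "\<exists>c :: nat \<Rightarrow> int. ev \<theta> h = (\<Sum>i<degree f. of_int (c i) * \<theta> ^ i)"
proof -
  obtain r where "degree r < degree f" "ev \<theta> h = ev \<theta> r" by (rule ev_reduce)
  then show ?thesis using ev_eq_sum[of r "degree f" \<theta>] by (intro exI[of _ "Polynomial.coeff r"]) simp
qed

lemma algebraic_int_ev: "algebraic_int (ev \<theta> h)"
proof (rule algebraic_int_finite_module[of "{..<degree f}" "\<lambda>i. \<theta> ^ i"])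
  show "\<exists>i\<in>{..<degree f}. \<theta> ^ i \<noteq> 0" using degree_pos by (intro bexI[of _ 0]) auto
next
  fix i
  have eq: "ev \<theta> h * \<theta> ^ i = ev \<theta> (h * [:0, 1:] ^ i)" by simp
  show "\<exists>c::nat \<Rightarrow> int. ev \<theta> h * \<theta> ^ i = (\<Sum>j<degree f. of_int (c j) * \<theta> ^ j)"
    unfolding eq by (rule ev_eq_power_sum)
qed simp

text \<open>Multiplication by y maps the finitely generated module Z[\<theta>] + Z[\<theta>] y into
  itself. The index (i, b) stands for \<theta>^i, times y if b holds. This serves to show that the
  witness against monogenicity is integral.\<close>

lemma algebraic_int_quadratic:
  assumes y: "y * y = ev \<theta> u * y + ev \<theta> w"
  shows "algebraic_int y"
proof -
  define v where "v = (\<lambda>(i, b). \<theta> ^ i * (if b then y else 1))"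
  let ?I = "{..<degree f} \<times> (UNIV :: bool set)"
  have repr: "\<exists>c::nat \<times> bool \<Rightarrow> int. ev \<theta> g + ev \<theta> h * y = (\<Sum>j\<in>?I. of_int (c j) * v j)" for g h
  proof -
    obtain a b where a: "ev \<theta> g = (\<Sum>i<degree f. of_int (a i) * \<theta> ^ i)"
      and b: "ev \<theta> h = (\<Sum>i<degree f. of_int (b i) * \<theta> ^ i)"
      using ev_eq_power_sum[of g] ev_eq_power_sum[of h] by blast
    have "(\<Sum>j\<in>?I. of_int ((\<lambda>(i, t). if t then b i else a i) j) * v j)
      = (\<Sum>i<degree f. \<Sum>t\<in>UNIV. of_int (if t then b i else a i) * v (i, t))"
      by (subst sum.cartesian_product) (auto intro!: sum.cong)
    also have "\<dots> = (\<Sum>i<degree f. of_int (a i) * \<theta> ^ i + of_int (b i) * \<theta> ^ i * y)"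
      by (simp add: UNIV_bool v_def mult_ac add.commute)
    also have "\<dots> = ev \<theta> g + ev \<theta> h * y"
      by (simp add: a b sum.distrib sum_distrib_right)
    finally show ?thesis by (intro exI) (rule sym)
  qed
  show ?thesis
  proof (rule algebraic_int_finite_module[of ?I v])
    show "\<exists>i\<in>?I. v i \<noteq> 0"
      using degree_pos by (intro bexI[of _ "(0, False)"]) (auto simp: v_def)
  next
    fix j assume "j \<in> ?I"
    obtain i b where j: "j = (i, b)" by fastforce
    have eq: "y * v j = ev \<theta> (if b then w * [:0, 1:] ^ i else 0) + ev \<theta> ((if b then u else 1) * [:0, 1:] ^ i) * y"
    proof -
      have "y * v j = (if b then (y * y) * \<theta> ^ i else \<theta> ^ i * y)" by (simp add: j v_def mult_ac)
      then show ?thesis unfolding y by (simp add: algebra_simps)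
    qed
    show "\<exists>c::nat \<times> bool \<Rightarrow> int. y * v j = (\<Sum>j\<in>?I. of_int (c j) * v j)" unfolding eq by (rule repr)
  qed simp
qed

lemma power_sum_eq_ev: "(\<Sum>i<n. of_int (c i) * \<theta> ^ i) = ev \<theta> (\<Sum>i<n. Polynomial.monom (c i) i)"
  by (simp add: ev_sum) (simp add: ev_def map_poly_monom poly_monom)

lemma powers_independent:
  assumes "(\<Sum>i<degree f. of_int (c i) * \<theta> ^ i) = 0" "i < degree f"
  shows "c i = 0"
proof -
  let ?h = "\<Sum>i<degree f. Polynomial.monom (c i) i"
  have "f dvd ?h" using assms(1) ev_eq_0_iff unfolding power_sum_eq_ev by blast
  moreover have "degree ?h < degree f"
    using degree_pos by (intro degree_sum_less) (auto intro: le_less_trans[OF degree_monom_le])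
  ultimately have "?h = 0" using dvd_imp_degree_le by (metis leD)
  then have "Polynomial.coeff ?h i = 0" by simp
  then show ?thesis using assms(2) by (simp add: coeff_sum)
qed

lemma ring_of_integers_subset:
  assumes max: "\<And>q g. prime q \<Longrightarrow> almost_integral \<theta> (ev \<theta> g / of_nat q) \<Longrightarrow>
      ev \<theta> g / of_nat q \<in> range (ev \<theta>)"
  shows "ring_of_integers \<theta> \<subseteq> range (ev \<theta>)"
proof
  fix \<beta> assume "\<beta> \<in> ring_of_integers \<theta>"
  then have \<beta>: "\<beta> \<in> num_field \<theta>" "algebraic_int \<beta>" by (auto simp: ring_of_integers_def)
  obtain N where N: "N > 0" "of_nat N * \<beta> \<in> range (ev \<theta>)"
    by (rule num_field_clear_denominator[OF \<beta>(1)])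
  then obtain g where g: "of_nat N * \<beta> = ev \<theta> g" by blast
  show "\<beta> \<in> range (ev \<theta>)"
    by (rule saturated[OF max N algebraic_int_imp_almost_integral[OF \<beta>(2) N(1) g]])
qed

lemma range_ev_subset: "range (ev \<theta>) \<subseteq> ring_of_integers \<theta>"
proof
  fix x assume "x \<in> range (ev \<theta>)"
  then obtain h where h: "x = ev \<theta> h" by blast
  have "x = poly (map_poly of_rat (map_poly rat_of_int h)) \<theta>"
    unfolding h ev_def by (simp add: map_poly_map_poly o_def)
  then have "x \<in> num_field \<theta>" unfolding num_field_def by blast
  then show "x \<in> ring_of_integers \<theta>"
    using algebraic_int_ev by (simp add: ring_of_integers_def h)
qed

lemma range_ev_eq: "range (ev \<theta>) = {\<Sum>i<degree f. of_int (c i) * \<theta> ^ i | c :: nat \<Rightarrow> int. True}"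
proof (intro equalityI subsetI)
  fix x assume "x \<in> range (ev \<theta>)"
  then show "x \<in> {\<Sum>i<degree f. of_int (c i) * \<theta> ^ i | c :: nat \<Rightarrow> int. True}"
    using ev_eq_power_sum by blast
next
  fix x assume "x \<in> {\<Sum>i<degree f. of_int (c i) * \<theta> ^ i | c :: nat \<Rightarrow> int. True}"
  then obtain c :: "nat \<Rightarrow> int" where "x = (\<Sum>i<degree f. of_int (c i) * \<theta> ^ i)" by blast
  then show "x \<in> range (ev \<theta>)" unfolding power_sum_eq_ev by simp
qed

end

lemma monogenicI:
  assumes "monic_irred f" and ord: "\<And>\<theta>. ev \<theta> f = 0 \<Longrightarrow> monogenic_order \<theta> f"
    and max: "\<And>\<theta> q g. ev \<theta> f = 0 \<Longrightarrow> prime q \<Longrightarrow> almost_integral \<theta> (ev \<theta> g / of_nat q) \<Longrightarrow>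
      ev \<theta> g / of_nat q \<in> range (ev \<theta>)"
  shows "monogenic f"
  unfolding monogenic_def
proof (intro conjI allI impI)
  fix \<theta> :: complex assume "poly (map_poly of_int f) \<theta> = 0"
  then have \<theta>: "ev \<theta> f = 0" by (simp add: ev_def)
  interpret monogenic_order \<theta> f by (rule ord[OF \<theta>])
  show "ring_of_integers \<theta> = {\<Sum>i<degree f. of_int (c i) * \<theta> ^ i | c :: nat \<Rightarrow> int. True}"
    using ring_of_integers_subset[OF max[OF \<theta>]] range_ev_subset unfolding range_ev_eq by blast
  fix c :: "nat \<Rightarrow> int" and i
  assume "(\<Sum>i<degree f. of_int (c i) * \<theta> ^ i) = 0" "i < degree f"
  then show "c i = 0" by (rule powers_independent)
qed (fact assms(1))

section \<open>Periods of Lucas sequences\<close>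

lemma U_add: "U k (m + n + 1) = U k (m + 1) * U k (n + 1) + U k m * U k n"
proof (induction k n rule: U.induct)
  case (3 k n)
  have "U k (m + Suc (Suc n) + 1) = k * U k (m + Suc n + 1) + U k (m + n + 1)"
    by simp
  then show ?case unfolding 3 by (simp add: algebra_simps)
qed (simp_all add: algebra_simps)

text \<open>The bracket is U_{m-1} written without a predecessor, so that m = 0 is covered.\<close>

lemma U_add': "U k (m + n) = U k m * U k (n + 1) + (U k (m + 1) - k * U k m) * U k n"
proof (cases m)
  case (Suc j)
  then show ?thesis using U_add[of k j n] by (simp add: algebra_simps)
qed simp

lemma U_cassini: "U k (n + 1) ^ 2 - k * U k (n + 1) * U k n - U k n ^ 2 = (-1) ^ n"
  by (induction n) (auto simp: algebra_simps power2_eq_square)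

text \<open>\<open>V\<close> is the companion sequence $V_n = U_{n+1} + U_{n-1}$, written without a predecessor.\<close>
definition V :: "int \<Rightarrow> nat \<Rightarrow> int" where
  "V k n = 2 * U k (n + 1) - k * U k n"

text \<open>Norm equation: V_n + U_n sqrt(k^2 + 4) is twice the n-th power of (k + sqrt(k^2 + 4))/2,
  a unit of norm -1.\<close>

lemma V_square: "V k n ^ 2 - (k\<^sup>2 + 4) * U k n ^ 2 = 4 * (-1) ^ n"
proof -
  have "V k n ^ 2 - (k\<^sup>2 + 4) * U k n ^ 2
      = 4 * (U k (n + 1) ^ 2 - k * U k (n + 1) * U k n - U k n ^ 2)"
    by (simp add: V_def algebra_simps power2_eq_square)
  then show ?thesis by (simp only: U_cassini)
qed

text \<open>The recurrence is determined by two consecutive values, so the return of the pair (0, 1)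
  suffices. Here 0 counts as a period; positivity is a separate hypothesis wherever it
  matters.\<close>

definition is_period :: "int \<Rightarrow> int \<Rightarrow> nat \<Rightarrow> bool" where
  "is_period k m n \<longleftrightarrow> [U k n = 0] (mod m) \<and> [U k (n + 1) = 1] (mod m)"

lemma is_period_iff: "is_period k m n \<longleftrightarrow> (\<forall>i. [U k (i + n) = U k i] (mod m))"
proof
  assume P: "is_period k m n"
  show "\<forall>i. [U k (i + n) = U k i] (mod m)"
  proof
    fix i
    show "[U k (i + n) = U k i] (mod m)"
    proof (induction i rule: less_induct)
      case (less i)
      consider "i = 0" | "i = 1" | j where "i = Suc (Suc j)"
        by (metis One_nat_def not0_implies_Suc)
      then show ?case
      proof cases
        case 3
        have "[k * U k (Suc j + n) + U k (j + n) = k * U k (Suc j) + U k j] (mod m)"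
          using less[of j] less[of "Suc j"] 3 by (intro cong_add cong_mult) auto
        then show ?thesis using 3 by simp
      qed (use P in \<open>simp_all add: is_period_def\<close>)
    qed
  qed
next
  assume *: "\<forall>i. [U k (i + n) = U k i] (mod m)"
  show "is_period k m n" using spec[OF *, of 0] spec[OF *, of 1] by (simp add: is_period_def)
qed

lemma is_period_add_cancel:
  assumes "is_period k m n" "is_period k m (r + n)"
  shows "is_period k m r"
  unfolding is_period_iff
proof
  fix i
  have "[U k (i + r + n) = U k (i + r)] (mod m)" "[U k (i + (r + n)) = U k i] (mod m)"
    using assms unfolding is_period_iff by blast+
  then show "[U k (i + r) = U k i] (mod m)"
    by (metis add.assoc cong_sym cong_trans)
qed

lemma is_period_mod:
  assumes "is_period k m n" "is_period k m N"
  shows "is_period k m (N mod n)"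
proof -
  have "is_period k m (r + j * n) \<Longrightarrow> is_period k m r" for r j
  proof (induction j)
    case (Suc j)
    then show ?case using is_period_add_cancel[OF assms(1), of "r + j * n"]
      by (simp add: algebra_simps)
  qed simp
  from this[of "N mod n" "N div n"] show ?thesis using assms(2)
    by (simp add: mod_div_mult_eq)
qed

lemma is_period_dvd_modulus:
  assumes "is_period k m n" "m' dvd m"
  shows "is_period k m' n"
  using assms cong_dvd_modulus unfolding is_period_def by blast

lemma period_is_period:
  assumes "is_period k m N" "N > 0"
  shows "is_period k m (period k m)" "period k m > 0"
proof -
  have "period k m > 0 \<and> (\<forall>i. [U k (i + period k m) = U k i] (mod m))"
    unfolding period_def by (rule LeastI[of _ N]) (use assms is_period_iff in auto)
  then show "is_period k m (period k m)" "period k m > 0" by (auto simp: is_period_iff)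
qed

lemma period_dvd:
  assumes "is_period k m N" "N > 0"
  shows "period k m dvd N"
proof (rule ccontr)
  assume "\<not> period k m dvd N"
  then have pos: "N mod period k m > 0" by (simp add: mod_greater_zero_iff_not_dvd)
  have "is_period k m (N mod period k m)"
    using is_period_mod period_is_period assms by blast
  then have "period k m \<le> N mod period k m"
    using pos unfolding period_def[of k m] is_period_iff
    by (intro Least_le) (auto simp flip: period_def)
  moreover have "N mod period k m < period k m"
    using period_is_period(2)[OF assms] by simp
  ultimately show False by simp
qed

text \<open>The N-th power of the companion matrix is 1 + p B, and (1 + p B)^j is 1 + j p B modulo
  p^2, so the deviation from (0, 1) is linear in j. Taking j = p lifts a period to p^2; a j prime to
  p can be cancelled.\<close>

lemma U_mult_cong:
  assumes "is_period k p N"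
  shows "[U k (j * N) = int j * U k N] (mod p\<^sup>2) \<and>
         [U k (j * N + 1) = 1 + int j * (U k (N + 1) - 1)] (mod p\<^sup>2)"
proof (induction j)
  case (Suc j)
  obtain a b where a: "U k N = p * a" and b: "U k (N + 1) = 1 + p * b"
    using assms unfolding is_period_def
    by (metis cong_0_iff cong_iff_lin dvdE mult.commute cong_sym)
  let ?j = "int j"
  have eqs: "U k (Suc j * N) = U k (j * N) * U k (N + 1) + (U k (j * N + 1) - k * U k (j * N)) * U k N"
    "U k (Suc j * N + 1) = U k (j * N + 1) * U k (N + 1) + U k (j * N) * U k N"
    using U_add'[of k "j * N" N] U_add[of k "j * N" N] by (simp_all add: algebra_simps)
  have IH: "[U k (j * N) = ?j * (p * a)] (mod p\<^sup>2)" "[U k (j * N + 1) = 1 + ?j * (p * b)] (mod p\<^sup>2)"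
    using Suc unfolding a b by simp_all
  have "[U k (Suc j * N) = ?j * (p * a) * (1 + p * b) + (1 + ?j * (p * b) - k * (?j * (p * a))) * (p * a)] (mod p\<^sup>2)"
    unfolding eqs a b by (intro cong_add cong_mult cong_diff IH cong_refl)
  also have "?j * (p * a) * (1 + p * b) + (1 + ?j * (p * b) - k * (?j * (p * a))) * (p * a)
    = (?j + 1) * (p * a) + p\<^sup>2 * (?j * a * b + (?j * b - k * ?j * a) * a)"
    by (simp add: algebra_simps power2_eq_square)
  also have "[\<dots> = (?j + 1) * (p * a)] (mod p\<^sup>2)"
    by (simp add: cong_iff_dvd_diff)
  finally have 1: "[U k (Suc j * N) = int (Suc j) * U k N] (mod p\<^sup>2)"
    by (simp add: a algebra_simps)
  have "[U k (Suc j * N + 1) = (1 + ?j * (p * b)) * (1 + p * b) + ?j * (p * a) * (p * a)] (mod p\<^sup>2)"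
    unfolding eqs a b by (intro cong_add cong_mult cong_diff IH cong_refl)
  also have "(1 + ?j * (p * b)) * (1 + p * b) + ?j * (p * a) * (p * a)
    = 1 + (?j + 1) * (p * b) + p\<^sup>2 * (?j * b * b + ?j * a * a)"
    by (simp add: algebra_simps power2_eq_square)
  also have "[\<dots> = 1 + (?j + 1) * (p * b)] (mod p\<^sup>2)"
    by (simp add: cong_iff_dvd_diff)
  finally have 2: "[U k (Suc j * N + 1) = 1 + int (Suc j) * (U k (N + 1) - 1)] (mod p\<^sup>2)"
    unfolding b by (simp add: add.commute)
  from 1 2 show ?case by blast
qed simp

lemma is_period_square_mult:
  assumes "is_period k (int p) N"
  shows "is_period k ((int p)\<^sup>2) (p * N)"
proof -
  obtain a b where ab: "U k N = int p * a" "U k (N + 1) - 1 = int p * b"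
    using assms unfolding is_period_def cong_iff_dvd_diff by (auto elim!: dvdE)
  then have "[int p * U k N = 0] (mod (int p)\<^sup>2)" "[1 + int p * (U k (N + 1) - 1) = 1 + 0] (mod (int p)\<^sup>2)"
    unfolding ab by (simp_all add: cong_iff_dvd_diff power2_eq_square)
  then show ?thesis using U_mult_cong[OF assms, of p] unfolding is_period_def
    by (metis add.right_neutral cong_trans)
qed

lemma is_period_square_cancel:
  assumes "prime p" "is_period k (int p) n" "is_period k ((int p)\<^sup>2) (j * n)" "\<not> p dvd j"
  shows "is_period k ((int p)\<^sup>2) n"
proof -
  have cop: "coprime (int j) ((int p)\<^sup>2)"
    using prime_imp_coprime[OF assms(1,4)] by (simp add: coprime_commute)
  note L = U_mult_cong[OF assms(2), of j]
  have "[int j * U k n = int j * 0] (mod (int p)\<^sup>2)"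
    using L assms(3) unfolding is_period_def by (metis cong_sym cong_trans mult_zero_right)
  moreover have "[1 + int j * (U k (n + 1) - 1) = 1 + int j * 0] (mod (int p)\<^sup>2)"
    using L assms(3) unfolding is_period_def by (metis add.right_neutral cong_sym cong_trans mult_zero_right)
  then have "[int j * (U k (n + 1) - 1) = int j * 0] (mod (int p)\<^sup>2)"
    by (simp only: cong_add_lcancel)
  ultimately have "[U k n = 0] (mod (int p)\<^sup>2)" "[U k (n + 1) - 1 = 0] (mod (int p)\<^sup>2)"
    using cop cong_mult_lcancel by blast+
  then show ?thesis unfolding is_period_def
    by (simp add: cong_iff_dvd_diff)
qed

text \<open>The period modulo p divides N with a cofactor prime to p, and cancelling this cofactor
  makes it a period modulo p^2 as well.\<close>

lemma wall_sun_sunI: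
  assumes "prime p" "is_period k ((int p)\<^sup>2) N" "\<not> p dvd N"
  shows "wall_sun_sun k p"
proof -
  have N: "N > 0" using assms(3) by (cases N) auto
  have PN: "is_period k (int p) N" using assms(2) is_period_dvd_modulus by force
  note pp = period_is_period[OF PN N] and p2 = period_is_period[OF assms(2) N]
  obtain j where j: "N = j * period k (int p)"
    using period_dvd[OF PN N] by (metis dvdE mult.commute)
  then have "is_period k ((int p)\<^sup>2) (period k (int p))"
    using is_period_square_cancel[OF assms(1) pp(1), of j] assms(2,3) by (metis dvd_mult2)
  then have "period k ((int p)\<^sup>2) dvd period k (int p)"
    by (rule period_dvd) (fact pp)
  moreover have "period k (int p) dvd period k ((int p)\<^sup>2)"
    by (rule period_dvd[OF is_period_dvd_modulus[OF p2(1)] p2(2)]) simp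
  ultimately show ?thesis using assms(1) by (simp add: wall_sun_sun_def dvd_antisym)
qed

lemma wall_sun_sunD:
  assumes "wall_sun_sun k p" "is_period k (int p) N" "N > 0"
  shows "is_period k ((int p)\<^sup>2) N"
proof -
  have p: "prime p" "period k ((int p)\<^sup>2) = period k (int p)"
    using assms(1) by (auto simp: wall_sun_sun_def)
  \<comment> \<open>The multiple p N only ensures that a positive period modulo p^2 exists, so that
    \<open>period\<close> really is one.\<close>
  have "p * N > 0" using p(1) assms(3) by (simp add: prime_gt_0_nat)
  from period_is_period[OF is_period_square_mult[OF assms(2)] this]
  have "is_period k ((int p)\<^sup>2) (period k (int p))" unfolding p(2) by blast
  moreover obtain j where "N = j * period k (int p)"
    using period_dvd[OF assms(2,3)] by (metis dvdE mult.commute)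
  moreover have "is_period k ((int p)\<^sup>2) (j * n)" if "is_period k ((int p)\<^sup>2) n" for j n
  proof (induction j)
    case (Suc j)
    then show ?case using that unfolding is_period_iff
      by (metis add.assoc add.commute cong_trans mult_Suc)
  qed (simp add: is_period_def)
  ultimately show ?thesis by blast
qed

section \<open>The Wall-Sun-Sun condition in terms of V_p\<close>

lemma prime_power_dvd_minus_or_plus_one:
  fixes a :: int
  assumes "prime p" "odd p" "int p ^ i dvd a\<^sup>2 - 1"
  shows "[a = 1] (mod int p ^ i) \<or> [a = -1] (mod int p ^ i)"
proof -
  have *: "int p ^ i dvd (a - 1) * (a + 1)"
    using assms(3) by (simp add: algebra_simps power2_eq_square)
  have "\<not> (int p dvd a - 1 \<and> int p dvd a + 1)"
  proof
    assume "int p dvd a - 1 \<and> int p dvd a + 1"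
    then have "int p dvd (a + 1) - (a - 1)" using dvd_diff by blast
    then have "int p dvd int 2" by simp
    then have "p dvd 2" by (simp only: int_dvd_int_iff)
    then show False using primes_dvd_imp_eq[OF assms(1) two_is_prime_nat] assms(2) by simp
  qed
  then have "coprime (int p ^ i) (a - 1) \<or> coprime (int p ^ i) (a + 1)"
    using prime_imp_coprime[of "int p" "a - 1"] prime_imp_coprime[of "int p" "a + 1"] assms(1) by auto
  then have "int p ^ i dvd a - 1 \<or> int p ^ i dvd a + 1"
    using * by (auto simp: coprime_dvd_mult_left_iff coprime_dvd_mult_right_iff)
  then show ?thesis by (auto simp: cong_iff_dvd_diff)
qed

text \<open>For odd p the norm equation reads V_p^2 - k^2 = (k^2 + 4)(U_p^2 - 1), and k^2 + 4 is
  invertible modulo p.\<close>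

lemma U_cong_pm_one:
  assumes "prime p" "odd p" "\<not> int p dvd k\<^sup>2 + 4" "[V k p = k] (mod int p ^ i)"
  shows "[U k p = 1] (mod int p ^ i) \<or> [U k p = -1] (mod int p ^ i)"
proof (rule prime_power_dvd_minus_or_plus_one[OF assms(1,2)])
  have "(k\<^sup>2 + 4) * ((U k p)\<^sup>2 - 1) = (V k p)\<^sup>2 - k\<^sup>2"
    using V_square[of k p] assms(2) by (simp add: algebra_simps)
  moreover have "int p ^ i dvd (V k p)\<^sup>2 - k\<^sup>2"
    using cong_pow[OF assms(4), of 2] by (simp add: cong_iff_dvd_diff)
  ultimately have "int p ^ i dvd (k\<^sup>2 + 4) * ((U k p)\<^sup>2 - 1)" by simp
  moreover have "coprime (int p ^ i) (k\<^sup>2 + 4)"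
    using prime_imp_coprime[of "int p" "k\<^sup>2 + 4"] assms(1,3) by simp
  ultimately show "int p ^ i dvd (U k p)\<^sup>2 - 1"
    by (simp add: coprime_dvd_mult_right_iff)
qed

text \<open>If U_p = 1, then \<alpha>^p = \<alpha> and \<alpha>^(p-1) = 1. If U_p = -1, then
  \<alpha>^p is the conjugate -1/\<alpha>, so \<alpha>^(p+1) = -1 and only the double exponent gives
  1. Odd m permits division by 2 in the definition of \<open>V\<close>.\<close>

lemma is_period_if_U_pm_one:
  assumes "prime p" "odd m" "[V k p = k] (mod m)"
  shows "[U k p = 1] (mod m) \<Longrightarrow> is_period k m (p - 1)"
    and "[U k p = -1] (mod m) \<Longrightarrow> is_period k m (2 * (p + 1))"
proof -
  obtain r where r: "p = Suc r" using assms(1) by (metis not0_implies_Suc not_prime_0)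
  have cop: "coprime 2 m" using assms(2) by simp
  have rec: "U k (Suc p) = k * U k p + U k r" by (simp add: r)
  show "is_period k m (p - 1)" if U1: "[U k p = 1] (mod m)"
  proof -
    have "[V k p + k * U k p = k + k * 1] (mod m)"
      by (intro cong_add cong_mult assms(3) U1 cong_refl)
    then have "[2 * U k (p + 1) = 2 * k] (mod m)" by (simp add: V_def)
    then have "[U k (p + 1) = k] (mod m)" using cop cong_mult_lcancel by blast
    then have "[U k (p + 1) - k * U k p = k - k * 1] (mod m)"
      by (intro cong_diff cong_mult U1 cong_refl)
    then have "[U k r = 0] (mod m)" by (simp add: rec)
    then show ?thesis using U1 by (simp add: is_period_def r)
  qed
  show "is_period k m (2 * (p + 1))" if U1: "[U k p = -1] (mod m)"
  proof -
    have "[V k p + k * U k p = k + k * (-1)] (mod m)"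
      by (intro cong_add cong_mult assms(3) U1 cong_refl)
    then have "[2 * U k (p + 1) = 2 * 0] (mod m)" by (simp add: V_def)
    then have U0: "[U k (p + 1) = 0] (mod m)" using cop cong_mult_lcancel by blast
    have "[k * U k (p + 1) + U k p = k * 0 + (-1)] (mod m)"
      by (intro cong_add cong_mult U0 U1 cong_refl)
    then have U2: "[U k (p + 1 + 1) = -1] (mod m)" by simp
    have "[U k ((p + 1) + (p + 1) + 1) = (-1) * (-1) + 0 * 0] (mod m)"
      unfolding U_add[of k "p + 1" "p + 1"] by (intro cong_add cong_mult U0 U2)
    moreover have "[U k ((p + 1) + (p + 1)) = 0 * (-1) + (-1 - k * 0) * 0] (mod m)"
      unfolding U_add'[of k "p + 1" "p + 1"] by (intro cong_add cong_mult cong_diff U0 U2 cong_refl)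
    ultimately show ?thesis by (simp add: is_period_def flip: mult_2)
  qed
qed

lemma ex_is_period_not_dvd:
  assumes "prime p" "odd p" "\<not> int p dvd k\<^sup>2 + 4" "[V k p = k] (mod int p ^ i)"
  obtains N where "is_period k (int p ^ i) N" "\<not> p dvd N"
proof -
  have "odd (int p ^ i)" using assms(2) by simp
  note ex = is_period_if_U_pm_one[OF assms(1) this assms(4)]
  have p2: "p \<ge> 2" using assms(1) by (rule prime_ge_2_nat)
  have "\<not> p dvd p - 1" using dvd_imp_le[of p "p - 1"] p2 by auto
  moreover have "\<not> p dvd 2 * (p + 1)"
  proof
    assume "p dvd 2 * (p + 1)"
    then have "p dvd 2" using dvd_add_right_iff[of p "2 * p" 2] by simp
    then show False using primes_dvd_imp_eq[OF assms(1) two_is_prime_nat] assms(2) by simp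
  qed
  ultimately show ?thesis using ex that[of "p - 1"] that[of "2 * (p + 1)"] U_cong_pm_one[OF assms] by auto
qed

text \<open>V_p = k modulo p^2 yields a period p - 1 or 2 (p + 1) modulo p^2, both prime to p.
  Conversely, these are periods modulo p, the Wall-Sun-Sun property lifts them to p^2, and V_p is
  read off there.\<close>

lemma wall_sun_sun_iff_V:
  assumes p: "prime p" "odd p" and ram: "\<not> int p dvd k\<^sup>2 + 4" and Vp: "[V k p = k] (mod int p)"
  shows "wall_sun_sun k p \<longleftrightarrow> [V k p = k] (mod (int p)\<^sup>2)"
proof
  assume "[V k p = k] (mod (int p)\<^sup>2)"
  then obtain N where "is_period k ((int p)\<^sup>2) N" "\<not> p dvd N"
    using ex_is_period_not_dvd[OF p ram, of 2] by auto
  then show "wall_sun_sun k p" by (rule wall_sun_sunI[OF p(1)])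
next
  assume wss: "wall_sun_sun k p"
  let ?m = "(int p)\<^sup>2"
  obtain r where r: "p = Suc r" using p(1) by (metis not0_implies_Suc not_prime_0)
  have r0: "r > 0" using p(1) r by (cases r) auto
  have rec: "U k (p + 1) = k * U k p + U k r" by (simp add: r)
  have odd: "odd (int p)" using p(2) by simp
  have pm: "[U k p = 1] (mod int p) \<or> [U k p = -1] (mod int p)"
    using U_cong_pm_one[OF p ram, of 1] Vp by simp
  note ex = is_period_if_U_pm_one[OF p(1) odd Vp]
  from pm show "[V k p = k] (mod ?m)"
  proof
    assume "[U k p = 1] (mod int p)"
    then have "is_period k ?m r"
      using wall_sun_sunD[OF wss ex(1)] r r0 by simp
    then have U: "[U k r = 0] (mod ?m)" "[U k p = 1] (mod ?m)"
      by (simp_all add: is_period_def r)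
    have "[2 * (k * U k p + U k r) - k * U k p = 2 * (k * 1 + 0) - k * 1] (mod ?m)"
      by (intro cong_add cong_mult cong_diff U cong_refl)
    then show ?thesis by (simp only: V_def rec) simp
  next
    assume U1: "[U k p = -1] (mod int p)"
    then have per: "is_period k ?m (2 * (p + 1))"
      using wall_sun_sunD[OF wss ex(2)] by simp
    have two: "\<not> int p dvd 2"
    proof
      assume "int p dvd 2"
      then have "int p dvd int 2" by simp
      then have "p dvd 2" by (simp only: int_dvd_int_iff)
      then show False using primes_dvd_imp_eq[OF p(1) two_is_prime_nat] p(2) by simp
    qed
    have cop: "coprime ?m a" if "\<not> int p dvd a" for a
      using prime_imp_coprime[of "int p" a] p(1) that by simp
    have "[V k p + k * U k p = k + k * (-1)] (mod int p)"
      by (intro cong_add cong_mult Vp U1 cong_refl)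
    then have "[2 * U k (p + 1) = 2 * 0] (mod int p)" by (simp add: V_def)
    then have U0: "[U k (p + 1) = 0] (mod int p)" using odd cong_mult_lcancel[of "2::int" "int p" "U k (p + 1)" 0] by simp
    have "[k * U k (p + 1) + U k p = k * 0 + (-1)] (mod int p)"
      by (intro cong_add cong_mult U0 U1 cong_refl)
    then have U2: "[U k (p + 1 + 1) = -1] (mod int p)" by simp
    have "?m dvd U k ((p + 1) + (p + 1))"
      using per by (simp add: is_period_def cong_iff_dvd_diff flip: mult_2)
    \<comment> \<open>Known is \<alpha>^(2(p+1)) = 1 modulo p^2, wanted is \<alpha>^(p+1) = -1. The
      doubling formulas factor, and one factor in each is -2 modulo p, hence a unit, so the other
      carries all of p^2.\<close>
    then have "?m dvd U k (p + 1) * (2 * U k (p + 1 + 1) - k * U k (p + 1))"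
      unfolding U_add'[of k "p + 1" "p + 1"] by (simp add: algebra_simps)
    moreover have nd: "\<not> int p dvd 2 * U k (p + 1 + 1) - k * U k (p + 1)"
    proof -
      have "[2 * U k (p + 1 + 1) - k * U k (p + 1) = 2 * (-1) - k * 0] (mod int p)"
        by (intro cong_mult cong_diff U0 U2 cong_refl)
      from cong_dvd_iff[OF this] show ?thesis using two by simp
    qed
    ultimately have A: "?m dvd U k (p + 1)"
      by (simp only: coprime_dvd_mult_left_iff[OF cop[OF nd]])
    have "[U k ((p + 1) + (p + 1) + 1) = 1] (mod ?m)"
      using per by (simp add: is_period_def flip: mult_2)
    then have "?m dvd U k (p + 1 + 1) * U k (p + 1 + 1) + U k (p + 1) * U k (p + 1) - 1"
      unfolding U_add[of k "p + 1" "p + 1"] cong_iff_dvd_diff .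
    from dvd_diff[OF this dvd_mult[OF A, of "U k (p + 1)"]]
    have "?m dvd (U k (p + 1 + 1) + 1) * (U k (p + 1 + 1) - 1)"
      by (simp add: algebra_simps)
    moreover have nd: "\<not> int p dvd U k (p + 1 + 1) - 1"
    proof -
      have "[U k (p + 1 + 1) - 1 = -1 - 1] (mod int p)" by (intro cong_diff U2 cong_refl)
      from cong_dvd_iff[OF this] show ?thesis using two by simp
    qed
    ultimately have B: "?m dvd U k (p + 1 + 1) + 1"
      by (simp only: coprime_dvd_mult_left_iff[OF cop[OF nd]])
    have "U k (p + 1 + 1) = k * U k (p + 1) + U k p" by simp
    then have "V k p - k = 2 * U k (p + 1) - k * (U k (p + 1 + 1) + 1) + k * k * U k (p + 1)"
      by (simp add: V_def algebra_simps)
    then show ?thesis using A B by (simp add: cong_iff_dvd_diff)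
  qed
qed

text \<open>Put t = c^2 + 1. Modulo m the roots of x^2 - kx - 1 are c + e and c - e with e^2 = t and
  t^2 = 0, so the binomial series for U_n stops after n c^(n-1) + binom(n,3) c^(n-3) t. The factor 6
  c^3 clears the denominators.\<close>

lemma U_cong_expansion:
  fixes c :: int
  assumes "[2 * c = k] (mod m)" "[(c\<^sup>2 + 1)\<^sup>2 = 0] (mod m)"
  shows "[6 * c ^ 3 * U k n =
           c ^ n * (6 * int n * c\<^sup>2 + int n * (int n - 1) * (int n - 2) * (c\<^sup>2 + 1))] (mod m)"
proof (induction n rule: less_induct)
  case (less n)
  define t where "t = c\<^sup>2 + 1"
  let ?W = "\<lambda>n. 6 * int n * c\<^sup>2 + int n * (int n - 1) * (int n - 2) * t"
  consider "n = 0" | "n = 1" | j where "n = Suc (Suc j)"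
    by (metis One_nat_def not0_implies_Suc)
  then show ?case
  proof cases
    case 3
    define i where "i = int j"
    have IH: "[6 * c ^ 3 * U k (Suc j) = c ^ Suc j * ?W (Suc j)] (mod m)"
      "[6 * c ^ 3 * U k j = c ^ j * ?W j] (mod m)"
      using less[of j] less[of "Suc j"] 3 by (simp_all add: t_def)
    have "[k * (6 * c ^ 3 * U k (Suc j)) + 6 * c ^ 3 * U k j
        = (2 * c) * (c ^ Suc j * ?W (Suc j)) + c ^ j * ?W j] (mod m)"
      by (rule cong_add[OF cong_mult[OF cong_sym[OF assms(1)] IH(1)] IH(2)])
    also have "(2 * c) * (c ^ Suc j * ?W (Suc j)) + c ^ j * ?W j
      = c ^ j * (2 * c\<^sup>2 * ?W (Suc j) + (t - c\<^sup>2) * ?W j)"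
      by (simp add: t_def algebra_simps power2_eq_square)
    also have "2 * c\<^sup>2 * ?W (Suc j) + (t - c\<^sup>2) * ?W j
      = c\<^sup>2 * ?W (Suc (Suc j)) + t\<^sup>2 * (i * (i - 1) * (i - 2))"
      unfolding of_nat_Suc i_def[symmetric] by (simp add: algebra_simps power2_eq_square)
    also have "[c ^ j * (c\<^sup>2 * ?W (Suc (Suc j)) + t\<^sup>2 * (i * (i - 1) * (i - 2)))
      = c ^ j * (c\<^sup>2 * ?W (Suc (Suc j)) + 0 * (i * (i - 1) * (i - 2)))] (mod m)"
      using assms(2) unfolding t_def[symmetric] by (intro cong_mult cong_add cong_refl)
    finally show ?thesis using 3 by (simp add: t_def algebra_simps power2_eq_square)
  qed (simp_all add: t_def power2_eq_square power3_eq_cube mult_ac)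
qed

text \<open>The number 4p is a period modulo p because c^2 = -1 there, but modulo p^2 the expansion
  gives U_{4p} = 4p c^(4p-1), which does not vanish.\<close>

lemma not_wall_sun_sun_ramified:
  assumes "prime p" "odd p" "int p dvd k\<^sup>2 + 4"
  shows "\<not> wall_sun_sun k p"
proof
  assume wss: "wall_sun_sun k p"
  let ?p = "int p"
  have pr: "prime ?p" and oddp: "odd ?p" using assms by simp_all
  have p2: "\<not> ?p dvd 2"
  proof
    assume "?p dvd 2"
    then have "?p dvd int 2" by simp
    then have "p dvd 2" by (simp only: int_dvd_int_iff)
    then show False using primes_dvd_imp_eq[OF assms(1) two_is_prime_nat] assms(2) by simp
  qed
  \<comment> \<open>The factor 6 of the expansion must be cancelled; p = 3 is impossible since k^2 +
    4 is 1 or 2 modulo 3.\<close>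
  have p3: "\<not> ?p dvd 3"
  proof
    assume "?p dvd 3"
    then have "?p dvd int 3" by simp
    then have "p dvd 3" by (simp only: int_dvd_int_iff)
    then have "p = 3" using primes_dvd_imp_eq[OF assms(1), of 3] by simp
    then have 3: "(k\<^sup>2 + 4) mod 3 = 0" using assms(3) by simp
    have "k mod 3 = 0 \<or> k mod 3 = 1 \<or> k mod 3 = 2" by presburger
    then have "(k\<^sup>2 + 4) mod 3 \<noteq> 0"
      using power_mod[of k 3 2] mod_add_left_eq[of "k\<^sup>2" 3 4] by auto
    then show False using 3 by simp
  qed
  have "even (?p\<^sup>2 + 1)" using oddp by simp
  \<comment> \<open>\<open>h\<close> is the inverse of 2 modulo p^2, so \<open>c\<close> is k/2, the
    double root modulo p.\<close>
  then obtain h where h: "2 * h = ?p\<^sup>2 + 1" by (metis evenE)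
  define c where "c = h * k"
  have c: "[2 * c = k] (mod ?p\<^sup>2)"
  proof -
    have "2 * c - k = (2 * h - 1) * k" by (simp add: c_def algebra_simps)
    also have "\<dots> = ?p\<^sup>2 * k" by (simp add: h)
    finally have "2 * c - k = ?p\<^sup>2 * k" .
    then show ?thesis by (simp add: cong_iff_dvd_diff)
  qed
  define t where "t = c\<^sup>2 + 1"
  have "[2 * c = k] (mod ?p)" using c cong_dvd_modulus[of "2 * c" k "?p\<^sup>2" ?p] by simp
  then have "[(2 * c)\<^sup>2 + 4 = k\<^sup>2 + 4] (mod ?p)" by (intro cong_add cong_pow cong_refl)
  then have "?p dvd (2 * c)\<^sup>2 + 4" using assms(3) cong_dvd_iff by blast
  then have "?p dvd 2 * 2 * t" by (simp add: t_def power_mult_distrib)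
  then have pt: "?p dvd t" using p2 pr by (metis prime_dvd_mult_iff)
  have pc: "\<not> ?p dvd c"
  proof
    assume "?p dvd c"
    then have "?p dvd t - c * c" using pt by (intro dvd_diff) auto
    then show False using pr by (simp add: t_def power2_eq_square)
  qed
  have t2: "[(c\<^sup>2 + 1)\<^sup>2 = 0] (mod ?p\<^sup>2)" using pt unfolding t_def[symmetric] by (simp add: cong_iff_dvd_diff)
  define W where "W n = 6 * int n * c\<^sup>2 + int n * (int n - 1) * (int n - 2) * t" for n
  have exp: "[6 * c ^ 3 * U k n = c ^ n * W n] (mod ?p\<^sup>2)" for n
    using U_cong_expansion[OF c t2, of n] by (simp add: W_def t_def)
  have expp: "[6 * c ^ 3 * U k n = c ^ n * W n] (mod ?p)" for n
    using exp cong_dvd_modulus[of _ _ "?p\<^sup>2" ?p] by simp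
  have p6: "\<not> ?p dvd 6 * c ^ 3"
  proof
    assume "?p dvd 6 * c ^ 3"
    then have "?p dvd 2 * (3 * c ^ 3)" by simp
    then show False using p2 p3 pc pr by (metis prime_dvd_mult_iff prime_dvd_power)
  qed
  then have cop: "coprime (6 * c ^ 3) ?p" "coprime (6 * c ^ 3) (?p\<^sup>2)"
    using prime_imp_coprime[of ?p "6 * c ^ 3"] pr by (simp_all add: coprime_commute)
  have "is_period k ?p (4 * p)" unfolding is_period_def
  proof
    have "?p dvd W (4 * p)" by (simp add: W_def)
    then have "[c ^ (4 * p) * W (4 * p) = 6 * c ^ 3 * 0] (mod ?p)" by (simp add: cong_iff_dvd_diff)
    with expp have "[6 * c ^ 3 * U k (4 * p) = 6 * c ^ 3 * 0] (mod ?p)" by (rule cong_trans)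
    then show "[U k (4 * p) = 0] (mod ?p)" using cop(1) cong_mult_lcancel by blast
    have "?p dvd W (4 * p + 1) - 6 * c\<^sup>2" by (simp add: W_def algebra_simps)
    then have "[W (4 * p + 1) = 6 * c\<^sup>2] (mod ?p)" by (simp add: cong_iff_dvd_diff)
    moreover have "?p dvd c\<^sup>2 - (-1)" using pt by (simp add: t_def)
    then have "[c\<^sup>2 = -1] (mod ?p)" by (simp only: cong_iff_dvd_diff)
    then have "[(c\<^sup>2) ^ (2 * p) = (-1) ^ (2 * p)] (mod ?p)" by (rule cong_pow)
    then have "[c ^ (4 * p) = 1] (mod ?p)" by (simp flip: power_mult)
    ultimately have "[c ^ (4 * p) * (c * W (4 * p + 1)) = 1 * (c * (6 * c\<^sup>2))] (mod ?p)"
      by (intro cong_mult cong_refl)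
    then have "[c ^ (4 * p + 1) * W (4 * p + 1) = 6 * c ^ 3 * 1] (mod ?p)"
      by (simp add: algebra_simps power2_eq_square power3_eq_cube)
    with expp have "[6 * c ^ 3 * U k (4 * p + 1) = 6 * c ^ 3 * 1] (mod ?p)" by (rule cong_trans)
    then show "[U k (4 * p + 1) = 1] (mod ?p)" using cop(1) cong_mult_lcancel by blast
  qed
  then have "is_period k (?p\<^sup>2) (4 * p)"
    using wall_sun_sunD[OF wss] assms(1) by (simp add: prime_gt_0_nat)
  then have "[U k (4 * p) = 0] (mod ?p\<^sup>2)" by (simp add: is_period_def)
  then have "[6 * c ^ 3 * U k (4 * p) = 6 * c ^ 3 * 0] (mod ?p\<^sup>2)" by (intro cong_mult cong_refl)
  from cong_trans[OF cong_sym[OF exp] this]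
  have d1: "?p\<^sup>2 dvd c ^ (4 * p) * W (4 * p)" by (simp add: cong_iff_dvd_diff)
  obtain s where s: "t = ?p * s" using pt by blast
  \<comment> \<open>The second term of the expansion gets one p from n = 4p and another from t, so
    only the linear term survives modulo p^2.\<close>
  have "c ^ (4 * p) * W (4 * p) = ?p * (24 * c ^ (4 * p + 2)) + ?p\<^sup>2 * (4 * (4 * ?p - 1) * (4 * ?p - 2) * s * c ^ (4 * p))"
    by (simp add: W_def s algebra_simps power2_eq_square power_add)
  then have "?p\<^sup>2 dvd ?p * (24 * c ^ (4 * p + 2))" using d1
    by (metis dvd_add_left_iff dvd_triv_left)
  then have "?p dvd 2 * (2 * (2 * (3 * c ^ (4 * p + 2))))"
    using assms(1) by (simp add: power2_eq_square)
  then show False using p2 p3 pc pr by (metis prime_dvd_mult_iff prime_dvd_power)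
qed

text \<open>For even k, 2 is a period modulo 2, and U_2 = k is not 0 modulo 4. For odd k, 3 is a
  period modulo 2, and U_3 = k^2 + 1 is 2 modulo 4.\<close>

lemma not_wall_sun_sun_2:
  assumes "\<not> 4 dvd k"
  shows "\<not> wall_sun_sun k 2"
proof
  assume wss: "wall_sun_sun k 2"
  have four: "(int 2)\<^sup>2 = 4" by simp
  show False
  proof (cases "even k")
    case True
    then have "is_period k (int 2) 2" by (simp add: is_period_def numeral_eq_Suc cong_iff_dvd_diff)
    from wall_sun_sunD[OF wss this] show False
      using assms by (simp add: four is_period_def cong_iff_dvd_diff eval_nat_numeral)
  next
    case False
    then have "is_period k (int 2) 3" by (simp add: is_period_def eval_nat_numeral cong_iff_dvd_diff)
    from wall_sun_sunD[OF wss this] have "4 dvd U k 3"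
      by (simp add: four is_period_def cong_iff_dvd_diff)
    then have "4 dvd k * k + 1" by (simp add: eval_nat_numeral)
    moreover have "(k * k + 1) mod 4 \<noteq> 0"
    proof -
      have "k mod 4 = 1 \<or> k mod 4 = 3" using False by presburger
      then show ?thesis using mod_mult_eq[of k 4 k] mod_add_left_eq[of "k * k" 4 1] by auto
    qed
    ultimately show False by simp
  qed
qed

section \<open>Irreducibility\<close>

lemma V_rec: "V t (n + 2) = t * V t (n + 1) + V t n"
  by (simp add: V_def algebra_simps)

lemma U_minus: "U (- t) (n + 1) = (-1) ^ n * U t (n + 1)"
proof (induction n rule: less_induct)
  case (less n)
  consider "n = 0" | "n = 1" | j where "n = Suc (Suc j)"
    by (metis One_nat_def not0_implies_Suc)
  then show ?case
  proof cases
    case 3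
    have "U (- t) (n + 1) = - t * U (- t) (Suc j + 1) + U (- t) (j + 1)" by (simp add: 3)
    also have "\<dots> = - t * ((-1) ^ Suc j * U t (Suc j + 1)) + (-1) ^ j * U t (j + 1)"
      using less[of j] less[of "Suc j"] 3 by simp
    also have "\<dots> = (-1) ^ n * (t * U t (Suc j + 1) + U t (j + 1))"
      by (simp add: 3 algebra_simps)
    also have "t * U t (Suc j + 1) + U t (j + 1) = U t (n + 1)" by (simp add: 3)
    finally show ?thesis .
  qed auto
qed

lemma U_mono_pos:
  assumes "t \<ge> 1"
  shows "1 \<le> U t (n + 1) \<and> U t (n + 1) \<le> U t (n + 2)"
proof (induction n)
  case (Suc n)
  have "1 * U t (n + 2) \<le> t * U t (n + 2)" using assms Suc by (intro mult_right_mono) linarith+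
  moreover have "U t (Suc n + 2) = t * U t (n + 2) + U t (n + 1)" "U t (Suc n + 1) = U t (n + 2)"
    by simp_all
  ultimately show ?case using Suc by linarith
qed (use assms in simp)

text \<open>Provides the nonunit whose square contradicts squarefreeness. The bound starts at 3,
  since U_1 = 1 and U_2 = t may be units.\<close>

lemma U_abs_ge_2:
  assumes "t \<noteq> 0" "n \<ge> 3"
  shows "\<bar>U t n\<bar> \<ge> 2"
proof -
  have pos: "U s (j + 3) \<ge> 2" if "s \<ge> 1" for s j
  proof (induction j)
    case 0
    have "1 * 1 \<le> s * s" using that by (intro mult_mono) auto
    then show ?case by (simp add: eval_nat_numeral)
  next
    case (Suc j)
    then show ?case using U_mono_pos[OF that, of "j + 2"] by (simp add: eval_nat_numeral)
  qed
  obtain j where n: "n = j + 3" using assms(2) by (metis add.commute le_iff_add)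
  show ?thesis
  proof (cases "t \<ge> 1")
    case True
    then show ?thesis using pos[of t j] n by simp
  next
    case False
    then have "U (- t) n \<ge> 2" using pos[of "- t" j] assms(1) n by simp
    moreover have "U (- t) n = (-1) ^ (j + 2) * U t n"
      using U_minus[of t "j + 2"] by (simp add: n eval_nat_numeral)
    ultimately show ?thesis by (cases "even j") auto
  qed
qed

text \<open>The discriminant condition makes $(k + \sqrt{k^2+4})/2$ a unit that is no proper power.\<close>
lemma not_V_odd_prime:
  fixes k :: int
  assumes p: "prime p" "odd p" and k: "k \<ge> 1" "\<not> 4 dvd k"
    and sqf: "squarefree ((k\<^sup>2 + 4) div (gcd 2 k)\<^sup>2)"
  shows "V t p \<noteq> k"
proof
  assume V: "V t p = k"
  have p3: "p \<ge> 3" using p prime_ge_2_nat[OF p(1)] by (cases "p = 2") auto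
  define u where "u = U t p"
  have eq: "u\<^sup>2 * (t\<^sup>2 + 4) = k\<^sup>2 + 4"
    using V_square[of t p] p(2) V by (simp add: u_def algebra_simps)
  have "t \<noteq> 0"
  proof
    assume "t = 0"
    have "U 0 (2 * j) = 0" for j by (induction j) auto
    moreover obtain j where "p + 1 = 2 * j" using p(2) by (metis evenE odd_even_add odd_one)
    ultimately have "V t p = 0" using \<open>t = 0\<close> unfolding V_def by simp
    then show False using V k by simp
  qed
  then have u: "\<bar>u\<bar> \<ge> 2" unfolding u_def using p3 by (rule U_abs_ge_2)
  then have not_unit: "\<not> is_unit u" by auto
  show False
  proof (cases "even k")
    case False
    then have "gcd 2 k = 1" by (simp flip: coprime_iff_gcd_eq_1)
    then have "squarefree (k\<^sup>2 + 4)" using sqf by simp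
    then show False using squarefreeD[of _ u] eq not_unit by (metis dvd_triv_left)
  next
    case True
    then obtain j where j: "k = 2 * j" by blast
    have "odd j" using k(2) by (auto simp: j elim!: evenE)
    have "gcd 2 k = 2" using True by (simp add: gcd_nat.absorb1 gcd_proj1_iff)
    then have sq: "squarefree (j\<^sup>2 + 1)" using sqf by (simp add: j power_mult_distrib)
    have eq4: "u\<^sup>2 * (t\<^sup>2 + 4) = 4 * (j\<^sup>2 + 1)" using eq by (simp add: j power_mult_distrib)
    show False
    proof (cases "even u")
      case False
      then have "coprime (u\<^sup>2) (2\<^sup>2)" by (simp only: coprime_power_left_iff coprime_power_right_iff) simp
      then have "coprime (u\<^sup>2) 4" by simp
      moreover have "u\<^sup>2 dvd 4 * (j\<^sup>2 + 1)" using eq4 by (metis dvd_triv_left)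
      ultimately have "u\<^sup>2 dvd j\<^sup>2 + 1" by (simp only: coprime_dvd_mult_right_iff)
      then show False using squarefreeD[OF sq] not_unit by blast
    next
      case True
      then obtain w where w: "u = 2 * w" by blast
      then have e: "w\<^sup>2 * (t\<^sup>2 + 4) = j\<^sup>2 + 1" using eq4 by (simp add: power_mult_distrib)
      \<comment> \<open>With j odd the right side is 2 modulo 4, while the left side is divisible by
        4 as soon as it is even: an even w gives 4 in w^2, an even t gives 4 in t^2 + 4.\<close>
      obtain i where i: "j = 2 * i + 1" using \<open>odd j\<close> by (rule oddE)
      have e2: "w\<^sup>2 * (t\<^sup>2 + 4) = 4 * (i * i + i) + 2"
        unfolding e i by (simp add: power2_eq_square algebra_simps)
      have "even (w\<^sup>2 * (t\<^sup>2 + 4))" unfolding e2 by simp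
      then have "even w \<or> even t" by auto
      then have "2\<^sup>2 dvd w\<^sup>2 \<or> 2\<^sup>2 dvd t\<^sup>2" using dvd_power_same by blast
      then have "4 dvd w\<^sup>2 \<or> 4 dvd t\<^sup>2 + 4" by simp
      then have "4 dvd w\<^sup>2 * (t\<^sup>2 + 4)" using dvd_mult dvd_mult2 by blast
      then have "4 dvd 4 * (i * i + i) + 2" unfolding e2 .
      then have "(4::int) dvd 2" using dvd_add_right_iff[of 4 "4 * (i * i + i)" 2] by simp
      then show False by simp
    qed
  qed
qed

section \<open>The field Q(\<alpha>) in coordinates, and the missing p-th root of \<alpha>\<close>

definition quad_field :: "complex \<Rightarrow> complex set" where
  "quad_field \<alpha> = {of_rat a + of_rat b * \<alpha> | a b. True}"

locale quadratic_unit =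
  fixes k :: int and \<alpha> :: complex
  assumes k: "k \<ge> 1" and root: "\<alpha> * \<alpha> = of_int k * \<alpha> + 1"
begin

definition conj_\<alpha> :: complex ("\<alpha>''") where "\<alpha>' = of_int k - \<alpha>"

lemma conj_mult: "\<alpha> * \<alpha>' = -1"
  using root by (simp add: conj_\<alpha>_def algebra_simps)

lemma conj_root: "\<alpha>' * \<alpha>' = of_int k * \<alpha>' + 1"
  using root by (simp add: conj_\<alpha>_def algebra_simps)

lemma \<alpha>_nonzero: "\<alpha> \<noteq> 0"
  using root by auto

text \<open>A rational \<alpha> would be an integer m with m (m - k) = 1, which forces k =
  0.\<close>

lemma not_rat: "\<alpha> \<notin> \<rat>"
proof
  assume rat: "\<alpha> \<in> \<rat>"
  have "algebraic_int \<alpha>" unfolding algebraic_int_altdef_ipoly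
    using root by (intro exI[of _ "[:-1, -k, 1:]"]) (simp add: algebra_simps)
  then obtain m where m: "\<alpha> = of_int m"
    using rational_algebraic_int_is_int rat by (metis Ints_cases)
  have "of_int (m * m) = (of_int (k * m + 1) :: complex)" using root by (simp add: m)
  then have mm: "m * (m - k) = 1" unfolding of_int_eq_iff by (simp add: algebra_simps)
  then have "m = 1 \<and> m - k = 1 \<or> m = -1 \<and> m - k = -1" by (rule zmult_eq_1_iff[THEN iffD1])
  then show False using k by auto
qed

lemma indep: "of_rat a + of_rat b * \<alpha> = of_rat c + of_rat d * \<alpha> \<longleftrightarrow> a = c \<and> b = d"
proof
  assume eq: "of_rat a + of_rat b * \<alpha> = of_rat c + of_rat d * \<alpha>"
  have "b = d"
  proof (rule ccontr)
    assume "b \<noteq> d"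
    then have "of_rat (b - d) \<noteq> (0 :: complex)" by simp
    moreover have "of_rat (b - d) * \<alpha> = of_rat (c - a)" using eq by (simp add: of_rat_diff algebra_simps)
    ultimately have "\<alpha> = of_rat ((c - a) / (b - d))" by (simp add: of_rat_divide field_simps)
    then show False using not_rat by simp
  qed
  then show "a = c \<and> b = d" using eq by simp
qed simp

lemma mult_formula:
  assumes "x * x = of_int k * x + 1"
  shows "(of_rat a + of_rat b * x) * (of_rat c + of_rat d * x)
    = of_rat (a * c + b * d) + of_rat (a * d + b * c + of_int k * b * d) * x"
proof -
  have "(of_rat a + of_rat b * x) * (of_rat c + of_rat d * x)
    = of_rat a * of_rat c + (of_rat a * of_rat d + of_rat b * of_rat c) * x + of_rat b * of_rat d * (x * x)"
    by (simp add: algebra_simps)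
  then show ?thesis unfolding assms by (simp add: of_rat_add of_rat_mult algebra_simps)
qed

lemma quad_field_mult: "x \<in> quad_field \<alpha> \<Longrightarrow> y \<in> quad_field \<alpha> \<Longrightarrow> x * y \<in> quad_field \<alpha>"
proof (unfold quad_field_def, elim CollectE exE conjE)
  fix a b c d assume "x = of_rat a + of_rat b * \<alpha>" "y = of_rat c + of_rat d * \<alpha>"
  then have "x * y = of_rat (a * c + b * d) + of_rat (a * d + b * c + of_int k * b * d) * \<alpha>"
    using mult_formula[OF root] by blast
  then show "x * y \<in> {of_rat a + of_rat b * \<alpha> | a b. True}" by blast
qed

lemma quad_field_diff: "x \<in> quad_field \<alpha> \<Longrightarrow> y \<in> quad_field \<alpha> \<Longrightarrow> x - y \<in> quad_field \<alpha>"
proof (unfold quad_field_def, elim CollectE exE conjE)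
  fix a b c d assume "x = of_rat a + of_rat b * \<alpha>" "y = of_rat c + of_rat d * \<alpha>"
  then have "x - y = of_rat (a - c) + of_rat (b - d) * \<alpha>" by (simp add: of_rat_diff algebra_simps)
  then show "x - y \<in> {of_rat a + of_rat b * \<alpha> | a b. True}" by blast
qed

lemma quad_field_of_rat: "of_rat a \<in> quad_field \<alpha>"
  unfolding quad_field_def by (rule CollectI, rule exI[of _ a], rule exI[of _ 0]) simp

lemma quad_field_add: "x \<in> quad_field \<alpha> \<Longrightarrow> y \<in> quad_field \<alpha> \<Longrightarrow> x + y \<in> quad_field \<alpha>"
  using quad_field_diff[OF _ quad_field_diff[OF quad_field_of_rat[of 0]], of x y] by simp

lemma quad_field_sum: "(\<And>i. i \<in> A \<Longrightarrow> x i \<in> quad_field \<alpha>) \<Longrightarrow> sum x A \<in> quad_field \<alpha>"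
  using quad_field_of_rat[of 0]
  by (induction A rule: infinite_finite_induct) (auto intro: quad_field_add)

lemma quad_field_\<alpha>: "\<alpha> \<in> quad_field \<alpha>"
  unfolding quad_field_def by (rule CollectI, rule exI[of _ 0], rule exI[of _ 1]) simp

lemma quad_field_power: "x \<in> quad_field \<alpha> \<Longrightarrow> x ^ n \<in> quad_field \<alpha>"
  using quad_field_of_rat[of 1] by (induction n) (auto intro: quad_field_mult)

lemma norm_formula:
  "(of_rat a + of_rat b * \<alpha>) * (of_rat a + of_rat b * \<alpha>') = of_rat (a * a + of_int k * a * b - b * b)"
proof -
  have "(of_rat a + of_rat b * \<alpha>) * (of_rat a + of_rat b * \<alpha>')
    = of_rat a * of_rat a + of_rat a * of_rat b * (\<alpha> + \<alpha>') + of_rat b * of_rat b * (\<alpha> * \<alpha>')"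
    by (simp add: algebra_simps)
  then show ?thesis unfolding conj_mult by (simp add: conj_\<alpha>_def of_rat_add of_rat_mult of_rat_diff algebra_simps)
qed

lemma quad_field_inverse:
  assumes "x \<in> quad_field \<alpha>"
  shows "inverse x \<in> quad_field \<alpha>"
proof (cases "x = 0")
  case True
  then show ?thesis using quad_field_of_rat[of 0] by simp
next
  case False
  obtain a b where x: "x = of_rat a + of_rat b * \<alpha>" using assms unfolding quad_field_def by blast
  define n where "n = a * a + of_int k * a * b - b * b"
  have conj: "of_rat a + of_rat b * \<alpha>' = of_rat (a + of_int k * b) - of_rat b * \<alpha>"
    by (simp add: conj_\<alpha>_def of_rat_add of_rat_mult algebra_simps)
  have n: "x * (of_rat a + of_rat b * \<alpha>') = of_rat n" unfolding x n_def by (rule norm_formula)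
  have "n \<noteq> 0"
  proof
    assume "n = 0"
    then have "of_rat (a + of_int k * b) + of_rat (- b) * \<alpha> = of_rat 0 + of_rat 0 * \<alpha>"
      using n False conj by (simp add: of_rat_minus)
    then have "b = 0" "a = 0" unfolding indep by auto
    then show False using False x by simp
  qed
  then have "inverse x = of_rat (1 / n) * (of_rat a + of_rat b * \<alpha>')"
    using n False by (simp add: of_rat_divide field_simps)
  also have "\<dots> \<in> quad_field \<alpha>" unfolding conj
    by (intro quad_field_mult quad_field_diff quad_field_of_rat quad_field_\<alpha>)
  finally show ?thesis .
qed

lemma power_conj:
  "\<exists>c d. (of_rat a + of_rat b * \<alpha>) ^ n = of_rat c + of_rat d * \<alpha> \<and>
         (of_rat a + of_rat b * \<alpha>') ^ n = of_rat c + of_rat d * \<alpha>'"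
proof (induction n)
  case 0
  show ?case by (rule exI[of _ 1], rule exI[of _ 0]) simp
next
  case (Suc n)
  then obtain c d where "(of_rat a + of_rat b * \<alpha>) ^ n = of_rat c + of_rat d * \<alpha>"
    "(of_rat a + of_rat b * \<alpha>') ^ n = of_rat c + of_rat d * \<alpha>'" by blast
  then show ?case using mult_formula[OF root, of a b c d] mult_formula[OF conj_root, of a b c d]
    by (intro exI[of _ "a * c + b * d"] exI[of _ "a * d + b * c + of_int k * b * d"]) simp
qed

text \<open>With y the conjugate of x, the sums x^i + y^i obey the recurrence of \<open>V\<close>
  with the trace t as parameter. Once t is known to be an integer, x^p + y^p = k contradicts
  \<open>not_V_odd_prime\<close>.\<close>

lemma \<alpha>_not_prime_power:
  assumes p: "prime p" and k4: "\<not> 4 dvd k"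
    and sqf: "squarefree ((k\<^sup>2 + 4) div (gcd 2 k)\<^sup>2)"
    and x: "x \<in> quad_field \<alpha>"
  shows "x ^ p \<noteq> \<alpha>"
proof
  assume xp: "x ^ p = \<alpha>"
  obtain a b where xab: "x = of_rat a + of_rat b * \<alpha>" using x unfolding quad_field_def by blast
  define y where "y = of_rat a + of_rat b * \<alpha>'"
  define n where "n = a * a + of_int k * a * b - b * b"
  have xy: "x * y = of_rat n" unfolding xab y_def n_def by (rule norm_formula)
  obtain c d where cd: "x ^ p = of_rat c + of_rat d * \<alpha>" "y ^ p = of_rat c + of_rat d * \<alpha>'"
    using power_conj[of a b p] unfolding xab y_def by blast
  have "of_rat c + of_rat d * \<alpha> = of_rat 0 + of_rat 1 * \<alpha>" using cd(1) xp by simp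
  then have "c = 0 \<and> d = 1" unfolding indep .
  then have yp: "y ^ p = \<alpha>'" using cd(2) by simp
  have "of_rat (n ^ p) = (of_rat (-1) :: complex)"
    using conj_mult by (simp add: of_rat_power power_mult_distrib xp yp flip: xy)
  then have np: "n ^ p = -1" by (simp only: of_rat_eq_iff)
  \<comment> \<open>The norm n of x satisfies n^p = -1, so p = 2 is excluded and n = -1.\<close>
  have odd: "odd p"
  proof
    assume "even p"
    then have "n ^ p \<ge> 0" by (rule zero_le_even_power)
    then show False using np by simp
  qed
  have "\<bar>n\<bar> ^ p = 1" using np by (simp flip: power_abs)
  then have "\<bar>n\<bar> = 1"
    using power_eq_imp_eq_base[of "\<bar>n\<bar>" p 1] prime_gt_0_nat[OF p] by simp
  then have n: "n = -1" using np by (auto simp: abs_if split: if_splits)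
  define t where "t = 2 * a + of_int k * b"
  have xpy: "x + y = of_rat t" by (simp add: xab y_def t_def conj_\<alpha>_def of_rat_add of_rat_mult algebra_simps)
  define W where "W i = x ^ i + y ^ i" for i
  have W_rec: "W (i + 2) = of_rat t * W (i + 1) + W i" for i
  proof -
    have "W (i + 2) = (x + y) * W (i + 1) - (x * y) * W i" by (simp add: W_def algebra_simps)
    then show ?thesis by (simp add: xpy xy n)
  qed
  have Wp: "W p = of_int k" by (simp add: W_def xp yp conj_\<alpha>_def)
  obtain m e where me: "quotient_of t = (m, e)" by fastforce
  then have t: "t = of_int m / of_int e" and e: "e > 0" and cop: "coprime m e"
    by (simp_all add: quotient_of_div quotient_of_denom_pos quotient_of_coprime)
  have te: "of_int e * of_rat t = (of_int m :: complex)" using e by (simp add: t of_rat_divide)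
  \<comment> \<open>With t = m/e in lowest terms, e^i W_i is m^i modulo e. Indices start at 1,
    because W_0 = 2 does not fit the pattern. At i = p the sum W_p = k is an integer, so e divides
    m^p and is a unit.\<close>
  have "(\<exists>z. of_int e ^ (i + 1) * W (i + 1) = of_int (m ^ (i + 1) + e * z)) \<and>
    (\<exists>z. of_int e ^ (i + 2) * W (i + 2) = of_int (m ^ (i + 2) + e * z))" for i
  proof (induction i)
    case 0
    have "of_int e ^ (0 + 1) * W (0 + 1) = of_int (m ^ (0 + 1) + e * 0)" by (simp add: W_def xpy te)
    moreover have "of_int e ^ 2 * W 2 = (of_int e * of_rat t) * (of_int e * of_rat t) + 2 * of_int e * of_int e"
      using W_rec[of 0] by (simp add: W_def xpy power2_eq_square algebra_simps)
    then have "of_int e ^ (0 + 2) * W (0 + 2) = of_int (m ^ (0 + 2) + e * (2 * e))"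
      unfolding te by (simp add: power2_eq_square numeral_2_eq_2)
    ultimately show ?case by blast
  next
    case (Suc i)
    then obtain z z' where z: "of_int e ^ (i + 1) * W (i + 1) = of_int (m ^ (i + 1) + e * z)"
      "of_int e ^ (i + 2) * W (i + 2) = of_int (m ^ (i + 2) + e * z')" by blast
    have i2: "Suc i + 1 = i + 2" "Suc i + 2 = i + 3" by simp_all
    have "of_int e ^ (i + 3) * W (i + 3) = (of_int e * of_rat t) * (of_int e ^ (i + 2) * W (i + 2))
      + of_int e * of_int e * (of_int e ^ (i + 1) * W (i + 1))"
      using W_rec[of "i + 1"] by (simp add: eval_nat_numeral algebra_simps)
    also have "\<dots> = of_int (m ^ (i + 3) + e * (m * z' + e * (m ^ (i + 1) + e * z)))"
      unfolding te z by (simp add: eval_nat_numeral algebra_simps)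
    finally have "of_int e ^ (Suc i + 2) * W (Suc i + 2)
        = of_int (m ^ (Suc i + 2) + e * (m * z' + e * (m ^ (i + 1) + e * z)))"
      unfolding i2 .
    moreover have "of_int e ^ (Suc i + 1) * W (Suc i + 1) = of_int (m ^ (Suc i + 1) + e * z')"
      unfolding i2 by (rule z(2))
    ultimately show ?case by blast
  qed
  moreover obtain r where "p = r + 1" using p by (metis Suc_eq_plus1 not0_implies_Suc not_prime_0)
  ultimately obtain z where "of_int e ^ p * W p = of_int (m ^ p + e * z)" by blast
  then have "of_int (e ^ p * k) = (of_int (m ^ p + e * z) :: complex)" by (simp add: Wp)
  then have "m ^ p = e ^ p * k - e * z" unfolding of_int_eq_iff by simp
  moreover have "e dvd e ^ p * k - e * z"
    using prime_gt_0_nat[OF p] by (intro dvd_diff dvd_mult2 dvd_power) auto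
  ultimately have "e dvd m ^ p" by simp
  moreover have "coprime e (m ^ p)" using cop by (simp add: coprime_commute)
  ultimately have "is_unit e" using coprime_common_divisor[of e "m ^ p" e] by simp
  then have tm: "t = of_int m" using e t by simp
  have "W i = of_int (V m i) \<and> W (i + 1) = of_int (V m (i + 1))" for i
  proof (induction i)
    case (Suc i)
    then show ?case using W_rec[of i] V_rec[of m i] by (simp add: tm)
  qed (simp add: W_def V_def xpy tm)
  then have "of_int (V m p) = (of_int k :: complex)" using Wp by simp
  then have "V m p = k" by (simp only: of_int_eq_iff)
  then show False using not_V_odd_prime[OF p odd k k4 sqf] by blast
qed

end

section \<open>The degree of \<theta> over Q(\<alpha>) and over Q\<close>

context quadratic_unit
begin

abbreviation over_field :: "complex poly \<Rightarrow> bool" where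
  "over_field h \<equiv> \<forall>i. Polynomial.coeff h i \<in> quad_field \<alpha>"

text \<open>Q(\<alpha>) is only a set of complex numbers here, so Euclidean division is carried out
  among complex polynomials while tracking that the coefficients stay in this set.\<close>

lemma over_field_division:
  assumes h: "over_field h" "h \<noteq> 0" and g: "over_field g"
  shows "\<exists>u. over_field u \<and> (g - h * u = 0 \<or> degree (g - h * u) < degree h)"
  using g
proof (induction "degree g" arbitrary: g rule: less_induct)
  case less
  show ?case
  proof (cases "g = 0 \<or> degree g < degree h")
    case True
    then show ?thesis using quad_field_of_rat[of 0] by (intro exI[of _ 0]) auto
  next
    case False
    then have g0: "g \<noteq> 0" and dg: "degree h \<le> degree g" by auto
    define c where "c = lead_coeff g * inverse (lead_coeff h)"
    define m where "m = Polynomial.monom c (degree g - degree h)"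
    have c: "c \<in> quad_field \<alpha>" unfolding c_def
      using h(1) less.prems by (intro quad_field_mult quad_field_inverse) auto
    have c0: "c \<noteq> 0" using g0 h(2) by (simp add: c_def)
    have om: "over_field m" using c quad_field_of_rat[of 0] by (simp add: m_def coeff_monom)
    have coeff_mh: "Polynomial.coeff (m * h) i \<in> quad_field \<alpha>" for i
      using c h(1) quad_field_of_rat[of 0]
      by (auto simp: m_def coeff_monom_mult intro: quad_field_mult)
    have og: "over_field (g - m * h)" using less.prems coeff_mh by (auto intro: quad_field_diff)
    have deg_m: "degree (m * h) = degree g"
      using c0 h(2) dg by (simp add: m_def degree_mult_eq degree_monom_eq monom_eq_0_iff)
    have "lead_coeff m = c" by (simp add: m_def degree_monom_eq[OF c0])
    then have "lead_coeff (m * h) = lead_coeff g"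
      using h(2) by (simp add: lead_coeff_mult c_def)
    then have lc: "Polynomial.coeff (g - m * h) (degree g) = 0" using deg_m by simp
    have "g - m * h = 0 \<or> degree (g - m * h) < degree g"
      using lc deg_m by (metis degree_diff_le leading_coeff_0_iff le_neq_implies_less order_refl)
    then obtain u where u: "over_field u" "g - m * h - h * u = 0 \<or> degree (g - m * h - h * u) < degree h"
    proof
      assume "g - m * h = 0"
      then show ?thesis using that[of 0] quad_field_of_rat[of 0] by simp
    next
      assume "degree (g - m * h) < degree g"
      then show ?thesis using less.hyps[OF _ og] that by blast
    qed
    have "over_field (m + u)"
      using om u(1) by (auto intro: quad_field_add)
    moreover have "g - h * (m + u) = g - m * h - h * u" by (simp add: algebra_simps)
    ultimately show ?thesis using u(2) by metis
  qed
qed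

text \<open>This is the classical irreducibility of x^p - \<alpha> over a field without a p-th root
  of \<alpha>. The minimal polynomial h of \<theta> divides x^p - \<alpha>, so the product \<eta> of
  its d roots satisfies \<eta>^p = \<alpha>^d, and \<eta> lies in Q(\<alpha>), being the constant
  coefficient of h up to sign and scaling.\<close>

lemma min_degree_over_field:
  assumes p: "prime p" and k4: "\<not> 4 dvd k"
    and sqf: "squarefree ((k\<^sup>2 + 4) div (gcd 2 k)\<^sup>2)"
    and \<theta>: "\<theta> ^ p = \<alpha>"
    and g: "over_field g" "g \<noteq> 0" "poly g \<theta> = 0"
  shows "degree g \<ge> p"
proof -
  define Z where "Z = (\<lambda>h. over_field h \<and> h \<noteq> 0 \<and> poly h \<theta> = 0)"
  define h where "h = arg_min degree Z"
  have Zh: "Z h" and min: "\<And>x. Z x \<Longrightarrow> degree h \<le> degree x"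
    using arg_min_nat_lemma[of Z g degree] g unfolding h_def Z_def by auto
  then have h: "over_field h" "h \<noteq> 0" "poly h \<theta> = 0" unfolding Z_def by auto
  have p0: "p > 0" using p by (rule prime_gt_0_nat)
  define P where "P = Polynomial.monom 1 p - [:\<alpha>:]"
  have oP: "over_field P"
    using quad_field_of_rat[of 0] quad_field_of_rat[of 1] quad_field_\<alpha>
      quad_field_diff[OF quad_field_of_rat[of 0] quad_field_\<alpha>]
    by (auto simp: P_def coeff_monom coeff_pCons split: nat.splits intro!: quad_field_diff)
  obtain u where u: "over_field u" "P - h * u = 0 \<or> degree (P - h * u) < degree h"
    using over_field_division[OF h(1,2) oP] by blast
  have "P = h * u"
  proof (rule ccontr)
    assume ne: "P \<noteq> h * u"
    have "over_field (P - h * u)"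
    proof
      fix i
      have "Polynomial.coeff (h * u) i \<in> quad_field \<alpha>"
        unfolding coeff_mult by (intro quad_field_sum quad_field_mult h(1)[rule_format] u(1)[rule_format])
      then show "Polynomial.coeff (P - h * u) i \<in> quad_field \<alpha>" using oP quad_field_diff by simp
    qed
    moreover have "poly (P - h * u) \<theta> = 0" using h(3) \<theta> by (simp add: P_def poly_monom)
    ultimately have "degree h \<le> degree (P - h * u)" using ne by (intro min) (simp add: Z_def)
    then show False using u(2) ne by auto
  qed
  define d where "d = degree h"
  have d0: "d > 0"
  proof (rule ccontr)
    assume "\<not> d > 0"
    then obtain c where "h = [:c:]" unfolding d_def by (metis degree_0_id gr0I degree_eq_zeroE)
    then show False using h by auto
  qed
  obtain as where as: "Polynomial.smult (lead_coeff h) (\<Prod>a\<leftarrow>as. [:- a, 1:]) = h" "length as = d"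
    using fundamental_theorem_algebra_factorized[of h] unfolding d_def by blast
  have roots: "a ^ p = \<alpha>" if "a \<in> set as" for a
  proof -
    have "poly (\<Prod>a\<leftarrow>as. [:- a, 1:]) a = 0"
      using that by (auto simp: poly_prod_list prod_list_zero_iff)
    then have "poly h a = 0" by (subst as(1)[symmetric]) simp
    then have "poly P a = 0" using \<open>P = h * u\<close> by simp
    then show ?thesis by (simp add: P_def poly_monom)
  qed
  define \<eta> where "\<eta> = prod_list as"
  have "\<eta> ^ p = \<alpha> ^ length as"
    unfolding \<eta>_def using roots by (induction as) (simp_all add: power_mult_distrib)
  then have \<eta>p: "\<eta> ^ p = \<alpha> ^ d" using as(2) by simp
  have "poly (\<Prod>a\<leftarrow>xs. [:- a, 1:]) 0 = (-1) ^ length xs * prod_list xs" for xs :: "complex list"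
    by (induction xs) simp_all
  then have "poly h 0 = lead_coeff h * ((-1) ^ d * \<eta>)"
    by (subst as(1)[symmetric]) (simp add: \<eta>_def as(2))
  then have "Polynomial.coeff h 0 * inverse (lead_coeff h) = (-1) ^ d * \<eta>"
    using h(2) by (simp add: poly_0_coeff_0)
  then have "(-1) ^ d * (Polynomial.coeff h 0 * inverse (lead_coeff h)) = \<eta>"
    by (cases "even d") simp_all
  moreover have "(-1) ^ d * (Polynomial.coeff h 0 * inverse (lead_coeff h)) \<in> quad_field \<alpha>"
    using quad_field_of_rat[of "-1"] h(1)
    by (intro quad_field_mult quad_field_inverse quad_field_power) (auto simp: of_rat_minus)
  ultimately have \<eta>: "\<eta> \<in> quad_field \<alpha>" by simp
  have "d \<ge> p"
  proof (rule ccontr)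
    assume "\<not> d \<ge> p"
    \<comment> \<open>If 0 < d < p, Bezout's relation d x = p y + 1 makes \<eta>^x / \<alpha>^y a
      p-th root of \<alpha> in Q(\<alpha>).\<close>
    then have "coprime p d" using p d0 by (intro prime_imp_coprime) (auto dest: dvd_imp_le)
    then have "gcd d p = 1" by (metis coprime_imp_gcd_eq_1 gcd.commute)
    then obtain x y where xy: "d * x = p * y + 1" using bezout_nat[of d p] d0 by auto
    have "(\<eta> ^ x) ^ p = (\<eta> ^ p) ^ x" "(\<alpha> ^ y) ^ p = \<alpha> ^ (p * y)"
      by (simp_all only: mult.commute flip: power_mult)
    then have "(\<eta> ^ x * inverse (\<alpha> ^ y)) ^ p = (\<eta> ^ p) ^ x * inverse (\<alpha> ^ (p * y))"
      by (simp add: power_mult_distrib power_inverse)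
    also have "(\<eta> ^ p) ^ x = \<alpha> ^ (p * y) * \<alpha>" unfolding \<eta>p power_mult[symmetric] xy by simp
    finally have "(\<eta> ^ x * inverse (\<alpha> ^ y)) ^ p = \<alpha>" using \<alpha>_nonzero by (simp add: field_simps)
    moreover have "\<eta> ^ x * inverse (\<alpha> ^ y) \<in> quad_field \<alpha>"
      by (intro quad_field_mult quad_field_inverse quad_field_power \<eta> quad_field_\<alpha>)
    ultimately show False using \<alpha>_not_prime_power[OF p k4 sqf] by blast
  qed
  then show ?thesis using min[of g] g unfolding d_def Z_def by auto
qed

text \<open>Since \<theta>^p = \<alpha>, pairing the coefficients at i and i + p turns g into a
  polynomial of degree below p over Q(\<alpha>). It must vanish, and 1, \<alpha> are independent
  over Q.\<close>

lemma min_degree_rat: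
  assumes p: "prime p" and k4: "\<not> 4 dvd k"
    and sqf: "squarefree ((k\<^sup>2 + 4) div (gcd 2 k)\<^sup>2)"
    and \<theta>: "\<theta> ^ p = \<alpha>"
    and g: "poly (map_poly of_rat g) \<theta> = 0" "degree g < 2 * p"
  shows "g = 0"
proof (rule ccontr)
  assume "g \<noteq> 0"
  define c where "c i = (of_rat (Polynomial.coeff g i) :: complex) + of_rat (Polynomial.coeff g (i + p)) * \<alpha>" for i
  define h where "h = (\<Sum>i<p. Polynomial.monom (c i) i)"
  have coeff_h: "Polynomial.coeff h i = (if i < p then c i else 0)" for i
    by (simp add: h_def coeff_sum coeff_monom)
  have oh: "over_field h"
    using quad_field_of_rat[of 0] unfolding coeff_h by (auto simp: c_def quad_field_def)
  have "poly h \<theta> = (\<Sum>i<p. of_rat (Polynomial.coeff g i) * \<theta> ^ i)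
      + (\<Sum>i<p. of_rat (Polynomial.coeff g (i + p)) * \<theta> ^ (i + p))"
    by (simp add: h_def c_def poly_sum poly_monom sum.distrib power_add \<theta> algebra_simps)
  also have "(\<Sum>i<p. of_rat (Polynomial.coeff g (i + p)) * \<theta> ^ (i + p))
      = (\<Sum>i\<in>{p..<2 * p}. of_rat (Polynomial.coeff g i) * \<theta> ^ i)"
    by (rule sum.reindex_bij_witness[of _ "\<lambda>i. i - p" "\<lambda>i. i + p"]) auto
  also have "(\<Sum>i<p. of_rat (Polynomial.coeff g i) * \<theta> ^ i) + \<dots>
      = (\<Sum>i\<in>{..<p} \<union> {p..<2 * p}. of_rat (Polynomial.coeff g i) * \<theta> ^ i)"
    by (rule sum.union_disjoint[symmetric]) auto
  also have "{..<p} \<union> {p..<2 * p} = {..<2 * p}" by auto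
  also have "(\<Sum>i<2 * p. of_rat (Polynomial.coeff g i) * \<theta> ^ i) = poly (map_poly of_rat g) \<theta>"
    unfolding poly_altdef using g(2)
    by (intro sum.mono_neutral_cong_right) (auto simp: coeff_eq_0)
  finally have "poly h \<theta> = 0" using g(1) by simp
  moreover have "degree h < p"
    unfolding h_def using prime_gt_0_nat[OF p]
    by (intro degree_sum_less) (auto intro: le_less_trans[OF degree_monom_le])
  ultimately have "h = 0" using min_degree_over_field[OF p k4 sqf \<theta> oh] by (metis leD)
  then have "c i = of_rat 0 + of_rat 0 * \<alpha>" if "i < p" for i using coeff_h[of i] that by simp
  then have c0: "Polynomial.coeff g i = 0 \<and> Polynomial.coeff g (i + p) = 0" if "i < p" for i
    using that unfolding c_def indep by blast
  have "Polynomial.coeff g i = 0" for i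
  proof -
    consider "i < p" | "p \<le> i" "i < 2 * p" | "i \<ge> 2 * p" by linarith
    then show ?thesis
    proof cases
      case 2
      then show ?thesis using c0[of "i - p"] by simp
    qed (use c0 g(2) in \<open>auto simp: coeff_eq_0\<close>)
  qed
  then show False using \<open>g \<noteq> 0\<close> by (simp add: poly_eq_iff)
qed

end

lemma F_eq: "F k p = [:0, 1:] ^ (2 * p) - [:k:] * [:0, 1:] ^ p - 1"
  by (simp add: F_def Polynomial.monom_altdef)

lemma degree_F:
  assumes "p > 0"
  shows "degree (F k p) = 2 * p" "lead_coeff (F k p) = 1"
proof -
  have c: "Polynomial.coeff (F k p) i = (if i = 2 * p then 1 else 0) - (if i = p then k else 0) - (if i = 0 then 1 else 0)" for i
    by (auto simp: F_def coeff_monom)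
  show deg: "degree (F k p) = 2 * p"
  proof (rule antisym)
    show "degree (F k p) \<le> 2 * p" by (rule degree_le) (use assms in \<open>auto simp: c\<close>)
    show "2 * p \<le> degree (F k p)" by (rule le_degree) (use assms in \<open>simp add: c\<close>)
  qed
  show "lead_coeff (F k p) = 1" using assms by (simp add: deg c)
qed

lemma ev_F: "ev \<theta> (F k p) = \<theta> ^ (2 * p) - of_int k * \<theta> ^ p - 1"
  by (simp add: F_eq)

context
  fixes p :: nat and k :: int
  assumes p: "prime p" and k1: "k \<ge> 1" and k4: "\<not> 4 dvd k"
    and sqf: "squarefree ((k\<^sup>2 + 4) div (gcd 2 k)\<^sup>2)"
begin

lemma F_min_degree:
  assumes "ev \<theta> (F k p) = 0" "poly (map_poly of_rat g) \<theta> = 0" "degree g < 2 * p"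
  shows "g = 0"
proof -
  have "\<theta> ^ p * \<theta> ^ p = \<theta> ^ (2 * p)" by (simp add: mult_2 power_add)
  then interpret quadratic_unit k "\<theta> ^ p"
    using assms(1) k1 by unfold_locales (simp_all add: ev_F algebra_simps)
  show ?thesis by (rule min_degree_rat[OF p k4 sqf refl assms(2,3)])
qed

lemma F_monogenic_order:
  assumes \<theta>: "ev \<theta> (F k p) = 0"
  shows "monogenic_order \<theta> (F k p)"
proof
  have p0: "p > 0" using p by (rule prime_gt_0_nat)
  show lc: "lead_coeff (F k p) = 1" and deg: "degree (F k p) > 0" using degree_F[OF p0] p0 by simp_all
  fix h
  show "ev \<theta> h = 0 \<longleftrightarrow> F k p dvd h"
  proof
    assume h: "ev \<theta> h = 0"
    obtain u r where ur: "h = F k p * u + r" "degree r < degree (F k p)"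
      by (rule monic_int_poly_division[OF lc deg])
    have "ev \<theta> r = 0" using h \<theta> ur(1) by simp
    then have "poly (map_poly of_rat (map_poly rat_of_int r)) \<theta> = 0"
      by (simp add: ev_def map_poly_map_poly o_def)
    then have "map_poly rat_of_int r = 0"
      using ur(2) degree_F(1)[OF p0] by (intro F_min_degree[OF \<theta>]) simp_all
    then have "r = 0" by simp
    then show "F k p dvd h" using ur(1) by simp
  next
    assume "F k p dvd h"
    then show "ev \<theta> h = 0" using \<theta> by (auto elim!: dvdE)
  qed
qed

lemma ex_root_F: "\<exists>\<theta>. ev \<theta> (F k p) = 0"
proof -
  have "degree (map_poly complex_of_int (F k p)) \<noteq> 0"
    using degree_F(1)[of p k] prime_gt_0_nat[OF p] by simp
  then have "\<exists>z. poly (map_poly complex_of_int (F k p)) z = 0"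
    using alg_closed_imp_poly_has_root by blast
  then show ?thesis by (simp add: ev_def)
qed

text \<open>In a factorisation one factor vanishes at \<theta>, so it has the full degree 2p and the
  other is constant.\<close>

lemma monic_irred_F: "monic_irred (F k p)"
  unfolding monic_irred_def
proof
  have p0: "p > 0" using p by (rule prime_gt_0_nat)
  show "lead_coeff (F k p) = 1" by (rule degree_F(2)[OF p0])
  let ?F = "map_poly rat_of_int (F k p)"
  have deg: "degree ?F = 2 * p" using degree_F(1)[OF p0] by simp
  obtain \<theta> where \<theta>: "ev \<theta> (F k p) = 0" using ex_root_F by blast
  show "irreducible ?F"
  proof (rule irreducibleI)
    show "?F \<noteq> 0" using deg p0 by auto
    show "\<not> is_unit ?F" using deg p0 by (simp add: is_unit_iff_degree)
    fix a b assume ab: "?F = a * b"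
    then have nz: "a \<noteq> 0" "b \<noteq> 0" using \<open>?F \<noteq> 0\<close> by auto
    then have dab: "degree a + degree b = 2 * p" using deg ab by (simp add: degree_mult_eq)
    have rt: "poly (map_poly of_rat ?F) \<theta> = 0" using \<theta> by (simp add: ev_def map_poly_map_poly o_def)
    interpret r: map_poly_comm_ring_hom "of_rat :: rat \<Rightarrow> complex" ..
    from rt have "poly (map_poly of_rat a) \<theta> = 0 \<or> poly (map_poly of_rat b) \<theta> = 0"
      unfolding ab by (simp add: r.hom_mult)
    then have "\<not> degree a < 2 * p \<or> \<not> degree b < 2 * p" using F_min_degree[OF \<theta>] nz by blast
    then have "degree a = 0 \<or> degree b = 0" using dab by linarith
    then show "is_unit a \<or> is_unit b" using nz by (simp add: is_unit_iff_degree)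
  qed
qed

end

section \<open>Maximality at each prime\<close>

text \<open>The linear remainder is U_n x + U_{n-1}. The general ring allows x to be replaced by x^p
  later.\<close>

lemma power_cong_U:
  fixes x :: "'a::comm_ring_1"
  shows "x * x - of_int k * x - 1 dvd x ^ n - (of_int (U k n) * x + of_int (U k (n + 1) - k * U k n))"
proof (induction n)
  case (Suc n)
  have "x ^ Suc n - (of_int (U k (Suc n)) * x + of_int (U k (Suc n + 1) - k * U k (Suc n)))
    = x * (x ^ n - (of_int (U k n) * x + of_int (U k (n + 1) - k * U k n)))
      + of_int (U k n) * (x * x - of_int k * x - 1)"
    by (simp add: algebra_simps)
  then show ?case using Suc by (auto intro!: dvd_add)
qed simp

lemma power_cong_V:
  fixes x :: "'a::comm_ring_1"
  shows "x * x - of_int k * x - 1 dvd x ^ (2 * n) - of_int (V k n) * x ^ n + (-1) ^ n"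
proof -
  define u where "u = U k n"
  define w where "w = U k (n + 1) - k * u"
  have V: "V k n = 2 * w + k * u" by (simp add: V_def u_def w_def)
  have c: "(-1 :: 'a) ^ n = of_int (w * w + k * u * w - u * u)"
  proof -
    have "w * w + k * u * w - u * u = (-1) ^ n"
      using U_cassini[of k n] by (simp add: u_def w_def algebra_simps power2_eq_square)
    then show ?thesis by (simp only:) simp
  qed
  let ?P = "of_int u * x + of_int w :: 'a"
  define y where "y = x ^ n"
  have y2: "x ^ (2 * n) = y * y" by (simp add: y_def mult_2 power_add)
  \<comment> \<open>The remainder P = U_n x + U_{n-1} has trace V_n and norm (-1)^n, so P^2 - V_n P
    + (-1)^n is a multiple of x^2 - kx - 1, namely u^2 times it.\<close>
  have eq: "x ^ (2 * n) - of_int (V k n) * x ^ n + (-1) ^ n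
    = (y - ?P) * (y + ?P - of_int (V k n)) + of_int (u * u) * (x * x - of_int k * x - 1)"
    unfolding c V y2 y_def[symmetric] by (simp add: algebra_simps)
  have "x * x - of_int k * x - 1 dvd y - ?P"
    unfolding y_def w_def u_def by (rule power_cong_U)
  then show ?thesis unfolding eq by (intro dvd_add dvd_mult2 dvd_mult dvd_refl)
qed

lemma is_period_power_mem:
  fixes x :: "'a::comm_ring_1"
  assumes "is_period k (int q) N"
  shows "x ^ N - 1 \<in> ideal2 (x * x - of_int k * x - 1) (of_nat q)"
proof -
  obtain a b where ab: "U k N = int q * a" "U k (N + 1) = 1 + int q * b"
    using assms unfolding is_period_def
    by (metis cong_0_iff cong_iff_lin dvdE mult.commute cong_sym)
  have "(of_int (U k N) * x + of_int (U k (N + 1) - k * U k N)) - 1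
    = of_nat q * (of_int a * x + of_int b - of_int k * of_int a)"
    unfolding ab by (simp add: algebra_simps)
  then have "(of_int (U k N) * x + of_int (U k (N + 1) - k * U k N)) - 1
      \<in> ideal2 (x * x - of_int k * x - 1) (of_nat q)"
    by (simp add: ideal2_dvd_right)
  then show ?thesis using ideal2_diff_trans[OF ideal2_dvd_left[OF power_cong_U]] by blast
qed

section \<open>The polynomial F modulo x^2 - kx - 1 and modulo primes\<close>

abbreviation X :: "int poly" where "X \<equiv> [:0, 1:]"

abbreviation char_quad :: "int \<Rightarrow> int poly" where
  "char_quad k \<equiv> X * X - of_int k * X - 1"

lemma char_quad_eq: "char_quad k = [:-1, -k, 1:]"
  by (simp add: of_int_poly one_pCons)

lemma F_eq_of_int: "F k p = X ^ (2 * p) - of_int k * X ^ p - 1"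
  by (simp add: F_eq of_int_poly)

lemma pcompose_of_int: "pcompose (of_int c) h = of_int c" for h :: "int poly"
  by (simp add: of_int_poly)

lemma pcompose_X: "pcompose X h = h" for h :: "int poly"
  by (simp add: pcompose_pCons)

lemma ex_F_eq_char_quad_power:
  assumes "prime p"
  obtains M where "F k p = char_quad k ^ p + of_nat p * M"
proof -
  have "pcompose (char_quad k) (X ^ p) = F k p"
    unfolding pcompose_diff pcompose_mult pcompose_of_int pcompose_X pcompose_1 F_eq_of_int
    by (simp add: mult_2 power_add)
  then have "of_nat p dvd char_quad k ^ p - F k p"
    using frobenius_int_poly[OF assms, of "char_quad k"] by simp
  then obtain h where "char_quad k ^ p - F k p = of_nat p * h" by blast
  then have "F k p = char_quad k ^ p + of_nat p * (- h)" by (simp add: algebra_simps)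
  then show ?thesis using that by blast
qed

lemma F_cong_V:
  assumes "odd p"
  obtains w where "F k p = char_quad k * w + X ^ p * of_int (V k p - k)"
proof -
  obtain w where "X ^ (2 * p) - of_int (V k p) * X ^ p + (-1) ^ p = char_quad k * w"
    using power_cong_V[of X k p] by blast
  then have "F k p = char_quad k * w + X ^ p * of_int (V k p - k)"
    using assms by (simp add: F_eq_of_int algebra_simps)
  then show ?thesis using that by blast
qed

text \<open>By Gauss's lemma q stays prime in Z[x], and it cannot divide a monic polynomial.\<close>

lemma monic_dvd_cancel:
  fixes s z :: "int poly"
  assumes "prime q" "lead_coeff s = 1" "of_nat q dvd s * z"
  shows "of_nat q dvd z"
proof -
  have "prime_elem [:int q:]" using assms(1) by (simp add: prime_elem_const_poly_iff)
  then have "[:int q:] dvd s \<or> [:int q:] dvd z"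
    using assms(3) by (simp add: of_nat_poly prime_elem_dvd_mult_iff)
  moreover have "\<not> [:int q:] dvd s"
  proof
    assume "[:int q:] dvd s"
    then have "int q dvd lead_coeff s" by (simp add: const_poly_dvd_iff)
    then show False using assms(1,2) by simp
  qed
  ultimately show ?thesis by (simp add: of_nat_poly)
qed

text \<open>Z/q embeds in Z[x]/(s, q): after division by the monic s the cofactor of q has degree
  below deg s, so the multiple of s must be 0.\<close>

lemma ideal2_of_int:
  fixes s :: "int poly"
  assumes s: "lead_coeff s = 1" "degree s > 0" and c: "of_int c \<in> ideal2 s (of_nat q)"
  shows "int q dvd c"
proof -
  obtain u v where uv: "of_int c = s * u + of_nat q * v" using c by (rule ideal2E)
  obtain v1 v2 where v: "v = s * v1 + v2" "degree v2 < degree s"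
    by (rule monic_int_poly_division[OF s])
  have eq: "of_int c - of_nat q * v2 = s * (u + of_nat q * v1)"
    using uv unfolding v(1) by (simp add: algebra_simps)
  have "degree (of_int c - of_nat q * v2) < degree s"
    using v(2) s(2) degree_mult_le[of "of_nat q" v2]
    by (intro degree_diff_less) (auto simp: of_int_poly of_nat_poly)
  then have "of_int c - of_nat q * v2 = 0"
    using dvd_imp_degree_le[of s "of_int c - of_nat q * v2"] eq by (metis dvd_triv_left leD)
  then have "Polynomial.coeff (of_int c) 0 = Polynomial.coeff (of_nat q * v2) 0" by simp
  then show ?thesis by (simp add: of_int_poly of_nat_poly)
qed

lemma X_inverse: "X ^ n * (X - of_int k) ^ n - 1 \<in> ideal2 (char_quad k) b"
proof -
  have "X * (X - of_int k) - 1 = char_quad k" by (simp only: right_diff_distrib mult.commute)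
  then have "(X * (X - of_int k)) ^ n - 1 ^ n \<in> ideal2 (char_quad k) b"
    by (intro ideal2_power_diff) (simp only: ideal2_generators)
  then show ?thesis by (simp only: power_mult_distrib power_one)
qed

text \<open>Modulo (s, p) with s = x^2 - kx - 1, F is s^p = 0 and also x^p (V_p - k). As x is a unit
  with inverse x - k, the integer V_p - k lies in (s, p).\<close>

lemma V_prime_cong:
  assumes p: "prime p" "odd p"
  shows "[V k p = k] (mod int p)"
proof -
  let ?I = "ideal2 (char_quad k) (of_nat p)"
  obtain M where M: "F k p = char_quad k ^ p + of_nat p * M" by (rule ex_F_eq_char_quad_power[OF p(1)])
  obtain w where w: "F k p = char_quad k * w + X ^ p * of_int (V k p - k)" by (rule F_cong_V[OF p(2)])
  have "char_quad k dvd char_quad k ^ p" by (rule dvd_power) (use prime_gt_0_nat[OF p(1)] in blast)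
  then have "F k p - char_quad k * w \<in> ?I" unfolding M
    by (intro ideal2_diff ideal2_add ideal2_dvd_left ideal2_dvd_right) auto
  then have "X ^ p * of_int (V k p - k) \<in> ?I" using w by simp
  then have 1: "X ^ p * of_int (V k p - k) * (X - of_int k) ^ p \<in> ?I" by (rule ideal2_mult)
  have 2: "(X ^ p * (X - of_int k) ^ p - 1) * of_int (V k p - k) \<in> ?I"
    by (rule ideal2_mult[OF X_inverse])
  have "of_int (V k p - k) = X ^ p * of_int (V k p - k) * (X - of_int k) ^ p
      - (X ^ p * (X - of_int k) ^ p - 1) * of_int (V k p - k)"
  proof -
    have "c = a * c * b - (a * b - 1) * c" for a b c :: "int poly" by (simp add: algebra_simps)
    then show ?thesis .
  qed
  then have "of_int (V k p - k) \<in> ?I" using ideal2_diff[OF 1 2] by metis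
  then have "int p dvd V k p - k"
    by (rule ideal2_of_int[rotated 2]) (simp_all only: char_quad_eq, simp_all)
  then show ?thesis by (simp add: cong_iff_dvd_diff)
qed

lemma is_period_2_3: "odd k \<Longrightarrow> is_period k 2 3"
  by (simp add: is_period_def eval_nat_numeral cong_iff_dvd_diff)

text \<open>Such a period is an exponent N prime to q with x^N = 1 modulo (s, q), s = x^2 - kx - 1,
  as \<open>ideal2_radical\<close> requires.\<close>

lemma ex_is_period_coprime:
  assumes q: "prime q" "\<not> int q dvd k\<^sup>2 + 4"
  obtains N where "is_period k (int q) N" "\<not> q dvd N"
proof (cases "odd q")
  case True
  then show ?thesis
    using that ex_is_period_not_dvd[OF q(1) True q(2), of 1] V_prime_cong[OF q(1) True] by auto
next
  case False
  then have "q = 2" using primes_dvd_imp_eq[OF two_is_prime_nat q(1)] by simp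
  then show ?thesis using that[of 3] q(2) is_period_2_3[of k] by auto
qed

text \<open>Choosing 2c = k modulo q^2, not just modulo q, gives 4 (c^2 + 1) = k^2 + 4 modulo q^2.
  For odd q squarefreeness then makes q divide c^2 + 1 exactly once, so m is invertible modulo q
  with inverse y.\<close>

lemma ex_ramified_root:
  fixes k :: int
  assumes q: "prime q" "int q dvd k\<^sup>2 + 4" and k4: "\<not> 4 dvd k"
    and sqf: "squarefree ((k\<^sup>2 + 4) div (gcd 2 k)\<^sup>2)"
  obtains c j m y z where "2 * c = k + (int q)\<^sup>2 * j" "c\<^sup>2 + 1 = int q * m" "y * m + z * int q = 1"
    "[c ^ (q - 1) = 1] (mod int q)"
proof -
  have "\<exists>c. (int q)\<^sup>2 dvd 2 * c - k \<and> int q dvd c\<^sup>2 + 1 \<and> \<not> (int q)\<^sup>2 dvd c\<^sup>2 + 1"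
  proof (cases "odd q")
    case False
    then have q2: "q = 2" using primes_dvd_imp_eq[OF two_is_prime_nat q(1)] by simp
    then have "even k" using q(2) by simp
    then obtain i where i: "k = 2 * i" by blast
    then have "odd i" using k4 by (auto elim!: evenE)
    \<comment> \<open>For q = 2 the value c = 1 works: k/2 is odd, so 4 divides 2 - k, and c^2 + 1 =
      2.\<close>
    then have "2 * 2 dvd 2 * (1 - i)" by (intro mult_dvd_mono) auto
    then show ?thesis using q2 by (intro exI[of _ 1]) (simp add: i)
  next
    case True
    then have "even ((int q)\<^sup>2 + 1)" by simp
    then obtain h where h: "2 * h = (int q)\<^sup>2 + 1" by (metis evenE)
    define c where "c = h * k"
    have "2 * c = (2 * h) * k" by (simp add: c_def)
    then have c: "2 * c = k + (int q)\<^sup>2 * k" unfolding h by (simp add: algebra_simps)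
    have four: "4 * (c\<^sup>2 + 1) = (k\<^sup>2 + 4) + (int q)\<^sup>2 * (2 * k * k + (int q)\<^sup>2 * k * k)"
    proof -
      have "4 * (c\<^sup>2 + 1) = (2 * c) * (2 * c) + 4" by (simp add: power2_eq_square)
      then show ?thesis unfolding c by (simp add: algebra_simps power2_eq_square)
    qed
    have "odd (int q)" using True by simp
    then have "coprime (int q) (2\<^sup>2)" by (simp only: coprime_power_right_iff) simp
    then have cop: "coprime (int q) 4" by simp
    have "int q dvd 4 * (c\<^sup>2 + 1)" unfolding four
      by (intro dvd_add q(2) dvd_mult2) simp
    then have 1: "int q dvd c\<^sup>2 + 1" using cop by (simp only: coprime_dvd_mult_right_iff)
    have "\<not> (int q)\<^sup>2 dvd c\<^sup>2 + 1"
    proof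
      assume "(int q)\<^sup>2 dvd c\<^sup>2 + 1"
      then have "(int q)\<^sup>2 dvd 4 * (c\<^sup>2 + 1) - (int q)\<^sup>2 * (2 * k * k + (int q)\<^sup>2 * k * k)"
        by (intro dvd_diff dvd_mult dvd_triv_left)
      then have sq: "(int q)\<^sup>2 dvd k\<^sup>2 + 4" unfolding four by simp
      have "(int q)\<^sup>2 dvd (k\<^sup>2 + 4) div (gcd 2 k)\<^sup>2"
      proof (cases "even k")
        case True
        then obtain i where i: "k = 2 * i" by blast
        have "gcd 2 k = 2" using True by (simp add: gcd_proj1_iff)
        moreover have "k\<^sup>2 + 4 = 4 * (i\<^sup>2 + 1)" by (simp add: i power_mult_distrib)
        moreover have "coprime ((int q)\<^sup>2) 4" using cop by simp
        ultimately show ?thesis using sq by (simp only: coprime_dvd_mult_right_iff) simp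
      next
        case False
        then have "gcd 2 k = 1" by (simp flip: coprime_iff_gcd_eq_1)
        then show ?thesis using sq by simp
      qed
      then have "is_unit (int q)" by (rule squarefreeD[OF sqf])
      then show False using q(1) by auto
    qed
    then show ?thesis using 1 c by (intro exI[of _ c]) simp
  qed
  then obtain c where c: "(int q)\<^sup>2 dvd 2 * c - k" "int q dvd c\<^sup>2 + 1" "\<not> (int q)\<^sup>2 dvd c\<^sup>2 + 1"
    by blast
  obtain j where j: "2 * c - k = (int q)\<^sup>2 * j" using c(1) by blast
  obtain m where m: "c\<^sup>2 + 1 = int q * m" using c(2) by blast
  have "\<not> int q dvd m"
  proof
    assume "int q dvd m"
    then have "(int q)\<^sup>2 dvd c\<^sup>2 + 1"
      unfolding m power2_eq_square[of "int q"] by (rule mult_dvd_mono[OF dvd_refl])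
    then show False using c(3) by blast
  qed
  then have "coprime (int q) m" using q(1) by (intro prime_imp_coprime) auto
  then have "gcd m (int q) = 1" by (metis coprime_imp_gcd_eq_1 gcd.commute)
  then obtain y z where yz: "y * m + z * int q = 1" using bezout_int[of m "int q"] by auto
  have "\<not> int q dvd c"
  proof
    assume "int q dvd c"
    then have "int q dvd (c\<^sup>2 + 1) - c * c" using c(2) by (intro dvd_diff dvd_mult2)
    then show False using q(1) by (simp add: power2_eq_square)
  qed
  moreover have "int q dvd c * (c ^ (q - 1) - 1)"
  proof -
    have "c * (c ^ (q - 1) - 1) = c ^ q - c"
      using prime_gt_0_nat[OF q(1)] by (cases q) (simp_all add: algebra_simps)
    then show ?thesis using fermat_int[OF q(1), of c] by simp
  qed
  ultimately have "int q dvd c ^ (q - 1) - 1"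
    using q(1) by (simp add: prime_dvd_mult_iff)
  then show ?thesis using that[of c j m y z] j m yz by (simp add: cong_iff_dvd_diff)
qed

section \<open>Dedekind's criterion for F, prime by prime\<close>

lemma prime_not_dvd_minus_1:
  assumes "prime q" shows "\<not> q dvd q - (1::nat)"
  using dvd_imp_le[of q "q - 1"] prime_ge_2_nat[OF assms] by auto

lemma power_minus_one_mem:
  fixes x :: "int poly"
  assumes "[c ^ n = 1] (mod int q)" "x - of_int c \<in> ideal2 s (of_nat q)"
  shows "x ^ n - 1 \<in> ideal2 s (of_nat q)"
proof -
  obtain d where "c ^ n - 1 = int q * d" using assms(1) by (auto simp: cong_iff_dvd_diff)
  then have "of_int (c ^ n - 1) = (of_nat q * of_int d :: int poly)" by simp
  then have "of_int c ^ n - 1 \<in> ideal2 s (of_nat q)" by (simp add: ideal2_dvd_right)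
  then show ?thesis using ideal2_diff_trans[OF ideal2_power_diff[OF assms(2)]] by blast
qed

lemma (in monic_annihilator) dedekind_order:
  assumes q: "prime q" and f: "f = s ^ e + of_nat q * M"
    and M: "b * M - 1 \<in> ideal2 s (of_nat q)"
    and N: "X ^ N - 1 \<in> ideal2 s (of_nat q)" "\<not> q dvd N"
    and e: "e > 0" and g: "almost_integral \<theta> (ev \<theta> g / of_nat q)"
  shows "ev \<theta> g / of_nat q \<in> range (ev \<theta>)"
  by (rule dedekind_maximal[OF q f M ideal2_radical[OF q N(2,1)] e g])

text \<open>F is squarefree modulo q, but F = F^1 + q 0 has the non-invertible cofactor 0;
  subtracting q from the base makes it 1. Since x^p is a root of y^2 - ky - 1 modulo F, x^(pN) = 1
  modulo (F, q), with pN prime to q.\<close>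

lemma F_maximal_unramified:
  assumes "monic_annihilator \<theta> (F k p)" and p: "prime p" and q: "prime q" "q \<noteq> p"
    and ram: "\<not> int q dvd k\<^sup>2 + 4" and g: "almost_integral \<theta> (ev \<theta> g / of_nat q)"
  shows "ev \<theta> g / of_nat q \<in> range (ev \<theta>)"
proof -
  interpret monic_annihilator \<theta> "F k p" by fact
  let ?I = "ideal2 (F k p - of_nat q) (of_nat q)"
  obtain N where N: "is_period k (int q) N" "\<not> q dvd N" by (rule ex_is_period_coprime[OF q(1) ram])
  have F: "X ^ p * X ^ p - of_int k * X ^ p - 1 = F k p"
    by (simp add: F_eq_of_int mult_2 power_add)
  have "X ^ (p * N) - 1 \<in> ideal2 (F k p) (of_nat q)"
    using is_period_power_mem[OF N(1), of "X ^ p"] unfolding F power_mult .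
  then obtain u v where uv: "X ^ (p * N) - 1 = F k p * u + of_nat q * v" by (rule ideal2E)
  have ord: "X ^ (p * N) - 1 \<in> ?I"
  proof (rule ideal2I[of _ _ u _ "u + v"])
    have "(F k p - of_nat q) * u + of_nat q * (u + v) = F k p * u + of_nat q * v"
      by (simp add: algebra_simps)
    then show "X ^ (p * N) - 1 = (F k p - of_nat q) * u + of_nat q * (u + v)"
      by (simp only: uv)
  qed
  have pN: "\<not> q dvd p * N"
    using N(2) q p primes_dvd_imp_eq[OF q(1) p] by (auto simp: prime_dvd_mult_iff)
  have one: "1 * 1 - 1 \<in> ?I" by (rule ideal2_dvd_left) simp
  have F1: "F k p = (F k p - of_nat q) ^ 1 + of_nat q * 1" by simp
  show ?thesis by (rule dedekind_order[OF q(1) F1 one ord pN _ g]) simp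
qed

text \<open>Completing the square in x^p gives F = (x^p - c)^2 + q (q j x^p - m), whose cofactor is
  -m modulo q. Moreover x^(p(q-1)) = c^(q-1) = 1 modulo (x^p - c, q).\<close>

lemma F_maximal_ramified:
  assumes "monic_annihilator \<theta> (F k p)" and p: "prime p" and q: "prime q" "q \<noteq> p"
    and ram: "int q dvd k\<^sup>2 + 4" and k4: "\<not> 4 dvd k"
    and sqf: "squarefree ((k\<^sup>2 + 4) div (gcd 2 k)\<^sup>2)"
    and g: "almost_integral \<theta> (ev \<theta> g / of_nat q)"
  shows "ev \<theta> g / of_nat q \<in> range (ev \<theta>)"
proof -
  interpret monic_annihilator \<theta> "F k p" by fact
  obtain c j m y z where c: "2 * c = k + (int q)\<^sup>2 * j" "c\<^sup>2 + 1 = int q * m" "y * m + z * int q = 1"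
    "[c ^ (q - 1) = 1] (mod int q)" by (rule ex_ramified_root[OF q(1) ram k4 sqf])
  define s where "s = X ^ p - of_int c"
  define M where "M = of_int (int q * j) * X ^ p - of_int m"
  let ?I = "ideal2 s (of_nat q)"
  have F: "F k p = s ^ 2 + of_nat q * M"
  proof -
    have "s ^ 2 + of_nat q * M = X ^ p * X ^ p - of_int (2 * c - int q * int q * j) * X ^ p + of_int (c\<^sup>2 - int q * m)"
      by (simp add: s_def M_def algebra_simps power2_eq_square)
    also have "2 * c - int q * int q * j = k" using c(1) by (simp add: power2_eq_square)
    also have "c\<^sup>2 - int q * m = -1" using c(2) by simp
    finally show ?thesis by (simp add: F_eq_of_int mult_2 power_add)
  qed
  have "of_int (- y) * M - 1 = of_int (y * m - 1) - of_nat q * (of_int (y * j) * X ^ p)"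
    by (simp add: M_def algebra_simps)
  also have "y * m - 1 = - (z * int q)" using c(3) by simp
  finally have "of_int (- y) * M - 1 = of_nat q * (- of_int z - of_int (y * j) * X ^ p)"
    by (simp add: algebra_simps)
  then have b: "of_int (- y) * M - 1 \<in> ?I" by (simp only: ideal2_dvd_right dvd_triv_left)
  have "X ^ p - of_int c \<in> ?I" unfolding s_def by (rule ideal2_generators)
  from power_minus_one_mem[OF c(4) this] have "X ^ (p * (q - 1)) - 1 \<in> ?I" by (simp only: power_mult)
  moreover have "\<not> q dvd p * (q - 1)"
    using prime_not_dvd_minus_1[OF q(1)] q p primes_dvd_imp_eq[OF q(1) p]
    by (auto simp: prime_dvd_mult_iff)
  ultimately show ?thesis by (rule dedekind_order[OF q(1) F b _ _ _ g]) simp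
qed

text \<open>Now x^p - c is (x - c)^p modulo p, so the base is x - c with exponent 2p. Modulo x - c
  the cofactor M is the integer M(c), found by evaluating F at c.\<close>

lemma F_maximal_self_ramified:
  assumes "monic_annihilator \<theta> (F k p)" and p: "prime p"
    and ram: "int p dvd k\<^sup>2 + 4" and k4: "\<not> 4 dvd k"
    and sqf: "squarefree ((k\<^sup>2 + 4) div (gcd 2 k)\<^sup>2)"
    and g: "almost_integral \<theta> (ev \<theta> g / of_nat p)"
  shows "ev \<theta> g / of_nat p \<in> range (ev \<theta>)"
proof -
  interpret monic_annihilator \<theta> "F k p" by fact
  have p0: "p > 0" using p by (rule prime_gt_0_nat)
  obtain c j m y z where c: "2 * c = k + (int p)\<^sup>2 * j" "c\<^sup>2 + 1 = int p * m" "y * m + z * int p = 1"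
    "[c ^ (p - 1) = 1] (mod int p)" by (rule ex_ramified_root[OF p ram k4 sqf])
  define s where "s = X - of_int c"
  let ?I = "ideal2 s (of_nat p)" and ?p = "of_nat p :: int poly"
  have F: "F k p = (X ^ p - of_int c)\<^sup>2 + ?p * (of_int (int p * j) * X ^ p - of_int m)"
  proof -
    have "(X ^ p - of_int c)\<^sup>2 + ?p * (of_int (int p * j) * X ^ p - of_int m)
      = X ^ p * X ^ p - of_int (2 * c - int p * int p * j) * X ^ p + of_int (c\<^sup>2 - int p * m)"
      by (simp add: algebra_simps power2_eq_square)
    also have "2 * c - int p * int p * j = k" using c(1) by (simp add: power2_eq_square)
    also have "c\<^sup>2 - int p * m = -1" using c(2) by simp
    finally show ?thesis by (simp add: F_eq_of_int mult_2 power_add)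
  qed
  have "pcompose s (X ^ p) = X ^ p - of_int c"
    unfolding s_def pcompose_diff pcompose_of_int pcompose_X ..
  then have "?p dvd s ^ p - (X ^ p - of_int c)" using frobenius_int_poly[OF p, of s] by simp
  then have "?p dvd (s ^ p)\<^sup>2 - (X ^ p - of_int c)\<^sup>2" using diff_dvd_power_diff dvd_trans by blast
  then obtain h where h: "(s ^ p)\<^sup>2 - (X ^ p - of_int c)\<^sup>2 = ?p * h" by blast
  define M where "M = of_int (int p * j) * X ^ p - of_int m - h"
  have sp: "s ^ (2 * p) = (s ^ p)\<^sup>2" by (simp add: mult.commute flip: power_mult)
  have FM: "F k p = s ^ (2 * p) + ?p * M"
    unfolding F sp M_def right_diff_distrib h[symmetric] by simp
  \<comment> \<open>By Fermat the square (c^p - c)^2 in F(c) is divisible by p^2, so it contributes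
    nothing to M(c) modulo p, which is therefore -m.\<close>
  obtain w where w: "c ^ p - c = int p * w" using fermat_int[OF p] by blast
  have "poly s c = 0" by (simp add: s_def of_int_poly)
  then have "poly (s ^ (2 * p)) c = 0" using p0 by (simp add: zero_power)
  then have "poly (F k p) c = int p * poly M c"
    unfolding FM by (simp add: of_nat_poly)
  moreover have "poly (F k p) c = (c ^ p - c)\<^sup>2 + int p * (int p * j * c ^ p - m)"
    unfolding F by (simp add: of_int_poly of_nat_poly)
  ultimately have "int p * poly M c = int p * (int p * (w\<^sup>2 + j * c ^ p) - m)"
    unfolding w by (simp add: algebra_simps power2_eq_square)
  then have Mc: "poly M c = int p * (w\<^sup>2 + j * c ^ p) - m" using p0 by simp
  have "X - [:c:] dvd pcompose M X - pcompose M [:c:]" by (rule diff_dvd_pcompose_diff)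
  moreover have "pcompose M [:c:] = of_int (poly M c)"
    by (simp add: pcompose_altdef of_int_poly flip: pcompose_pCons_0)
  moreover have "X - [:c:] = s" by (simp add: s_def of_int_poly)
  ultimately have "s dvd M - of_int (poly M c)" by simp
  then have "of_int (- y) * (M - of_int (poly M c)) \<in> ?I" by (intro ideal2_dvd_left dvd_mult)
  moreover have "of_int (- y) * of_int (poly M c) - 1 \<in> ?I"
  proof -
    have "- y * poly M c - 1 = (y * m - 1) - int p * (y * (w\<^sup>2 + j * c ^ p))"
      unfolding Mc by (simp add: algebra_simps)
    also have "y * m - 1 = - (z * int p)" using c(3) by simp
    finally have "- y * poly M c - 1 = int p * (- z - y * (w\<^sup>2 + j * c ^ p))" by (simp add: algebra_simps)
    then have "of_int (- y * poly M c - 1) = ?p * of_int (- z - y * (w\<^sup>2 + j * c ^ p))"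
      by (metis of_int_mult of_int_of_nat_eq)
    then have "of_int (- y * poly M c - 1) \<in> ?I" by (simp only: ideal2_dvd_right dvd_triv_left)
    then show ?thesis by simp
  qed
  ultimately have "of_int (- y) * (M - of_int (poly M c)) + (of_int (- y) * of_int (poly M c) - 1) \<in> ?I"
    by (rule ideal2_add)
  moreover have "of_int (- y) * (M - of_int (poly M c)) + (of_int (- y) * of_int (poly M c) - 1)
      = of_int (- y) * M - 1"
    by (simp only: right_diff_distrib)
  ultimately have b: "of_int (- y) * M - 1 \<in> ?I" by (simp only:)
  have "X - of_int c \<in> ?I" unfolding s_def by (rule ideal2_generators)
  from power_minus_one_mem[OF c(4) this] have "X ^ (p - 1) - 1 \<in> ?I" .
  then show ?thesis
    by (rule dedekind_order[OF p FM b _ prime_not_dvd_minus_1[OF p] _ g]) (use p0 in simp)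
qed

text \<open>The route through V_p needs odd p, so F = s^2 + 2 M is expanded by hand, with s = x^2 -
  kx - 1 and m = (k^2 + k - 2)/2. Modulo (s, 2) the cofactor M is x for even m and 1 for odd m, a
  unit either way.\<close>

lemma F_maximal_self_unramified_2:
  assumes "monic_annihilator \<theta> (F k 2)" and "odd k"
    and g: "almost_integral \<theta> (ev \<theta> g / of_nat 2)"
  shows "ev \<theta> g / of_nat 2 \<in> range (ev \<theta>)"
proof -
  interpret monic_annihilator \<theta> "F k 2" by fact
  obtain j where j: "k = 2 * j + 1" using \<open>odd k\<close> by (rule oddE)
  define m where "m = j * (2 * j + 3)"
  have m2: "k * k + k - 2 = 2 * m" by (simp add: j m_def algebra_simps)
  let ?s = "char_quad k"
  let ?I = "ideal2 ?s (of_nat 2)"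
  define x where "x = X"
  define M where "M = of_int k * x ^ 3 - of_int m * x\<^sup>2 - of_int k * x - 1"
  have F: "F k 2 = ?s ^ 2 + of_nat 2 * M"
  proof -
    have "?s ^ 2 + of_nat 2 * M = x ^ 4 + of_int (k * k - 2 - 2 * m) * x\<^sup>2 - 1"
      unfolding x_def[symmetric] M_def by (simp add: algebra_simps eval_nat_numeral)
    also have "k * k - 2 - 2 * m = - k" using m2 by simp
    finally show ?thesis by (simp add: F_eq_of_int x_def)
  qed
  have M: "M = ?s * (of_int k * x + of_int (k * k - m)) + (of_int (k * (k * k - m)) * x + of_int (k * k - 1 - m))"
    unfolding x_def[symmetric] M_def by (simp add: algebra_simps eval_nat_numeral)
  have two: "of_int (2 * i) * h \<in> ?I" for i h
    by (intro ideal2_dvd_right dvd_mult2) simp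
  have "\<exists>b. b * M - 1 \<in> ?I"
  proof (cases "even m")
    case True
    then obtain i where i: "m = 2 * i" by blast
    have "k * (k * k - m) - 1 = 2 * (j * (4 * j * j + 6 * j + 3) - k * i)" "k * k - 1 - m = 2 * (2 * j * j + 2 * j - i)"
      by (simp_all add: i j algebra_simps)
    then have "of_int (k * (k * k - m) - 1) * x + of_int (k * k - 1 - m) * 1 \<in> ?I"
      by (simp only: ideal2_add two)
    then have "of_int (k * (k * k - m) - 1) * x + of_int (k * k - 1 - m) * 1
        + ?s * (of_int k * x + of_int (k * k - m)) \<in> ?I"
      by (rule ideal2_add) (rule ideal2_dvd_left, simp only: dvd_triv_left)
    then have "M - x \<in> ?I" unfolding M by (simp add: algebra_simps)
    then have 1: "(X - of_int k) * (M - x) \<in> ?I" by (simp only: mult.commute ideal2_mult)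
    have 2: "X ^ 1 * (X - of_int k) ^ 1 - 1 \<in> ?I" by (rule X_inverse)
    have "(X - of_int k) * M - 1 = (X - of_int k) * (M - x) + (X ^ 1 * (X - of_int k) ^ 1 - 1)"
      unfolding x_def[symmetric] by (simp add: algebra_simps)
    then show ?thesis using ideal2_add[OF 1 2] by metis
  next
    case False
    then obtain i where i: "m = 2 * i + 1" by (rule oddE)
    have "k * (k * k - m) = 2 * (k * (2 * j * j + 2 * j - i))" "k * k - 1 - m - 1 = 2 * (2 * j * j + 2 * j - i - 1)"
      by (simp_all add: i j algebra_simps)
    then have "of_int (k * (k * k - m)) * x + of_int (k * k - 1 - m - 1) * 1 \<in> ?I"
      by (simp only: ideal2_add two)
    then have "of_int (k * (k * k - m)) * x + of_int (k * k - 1 - m - 1) * 1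
        + ?s * (of_int k * x + of_int (k * k - m)) \<in> ?I"
      by (rule ideal2_add) (rule ideal2_dvd_left, simp only: dvd_triv_left)
    then have "1 * M - 1 \<in> ?I" unfolding M by (simp add: algebra_simps)
    then show ?thesis by blast
  qed
  then obtain b where b: "b * M - 1 \<in> ?I" by blast
  have "is_period k (int 2) 3" using is_period_2_3[OF \<open>odd k\<close>] by simp
  note X3 = is_period_power_mem[OF this, of X]
  have n3: "\<not> (2::nat) dvd 3" by simp
  show ?thesis by (rule dedekind_order[OF two_is_prime_nat F b X3 n3 _ g]) simp
qed

lemma lead_coeff_char_quad: "lead_coeff (char_quad k) = 1"
  unfolding char_quad_eq by simp

text \<open>Modulo $x^2 - kx - 1$, the polynomial \<open>F k p\<close> is $x^p (V_p - k)$; this identifies the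
  cofactor \<open>M\<close> of Dedekind's criterion up to a unit.\<close>
lemma F_cofactor:
  assumes p: "prime p" "odd p"
  obtains v z where "V k p - k = int p * v"
    "F k p = char_quad k ^ p + of_nat p * (X ^ p * of_int v + char_quad k * z)"
proof -
  let ?s = "char_quad k"
  obtain M where M: "F k p = ?s ^ p + of_nat p * M" by (rule ex_F_eq_char_quad_power[OF p(1)])
  obtain w where w: "F k p = ?s * w + X ^ p * of_int (V k p - k)" by (rule F_cong_V[OF p(2)])
  obtain v where v: "V k p - k = int p * v"
    using V_prime_cong[OF p] by (auto simp: cong_iff_dvd_diff)
  obtain r where r: "p = Suc r" using p(1) by (metis not0_implies_Suc not_prime_0)
  define s where "s = ?s"
  have "of_nat p * (M - X ^ p * of_int v) = s * (w - s ^ r)"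
  proof -
    have "of_nat p * M = s * w + X ^ p * (of_nat p * of_int v) - s * s ^ r"
      using M w unfolding s_def[symmetric] v by (simp add: r algebra_simps)
    then show ?thesis by (simp add: algebra_simps)
  qed
  \<comment> \<open>Both expressions for F agree up to multiples of s. Because s is monic, p can be
    moved to the other factor and then cancelled.\<close>
  moreover from this have "of_nat p dvd w - s ^ r"
    using monic_dvd_cancel[OF p(1), of s "w - s ^ r"] lead_coeff_char_quad unfolding s_def
    by (metis dvd_triv_left)
  then obtain z where "w - s ^ r = of_nat p * z" by blast
  ultimately have "of_nat p * (M - X ^ p * of_int v) = of_nat p * (s * z)" by (simp add: mult_ac)
  then have "M - X ^ p * of_int v = s * z" using p(1) by simp
  then have "M = X ^ p * of_int v + s * z" by (simp add: algebra_simps)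
  then show ?thesis using that[OF v] M unfolding s_def by blast
qed

text \<open>Modulo (s, p), s = x^2 - kx - 1, the cofactor is x^p v with v = (V_p - k)/p prime to p.
  Its inverse is a (x - k)^p, where a inverts v.\<close>

lemma F_maximal_self_unramified_odd:
  assumes "monic_annihilator \<theta> (F k p)" and p: "prime p" "odd p"
    and ram: "\<not> int p dvd k\<^sup>2 + 4" and V: "\<not> [V k p = k] (mod (int p)\<^sup>2)"
    and g: "almost_integral \<theta> (ev \<theta> g / of_nat p)"
  shows "ev \<theta> g / of_nat p \<in> range (ev \<theta>)"
proof -
  interpret monic_annihilator \<theta> "F k p" by fact
  obtain v z where v: "V k p - k = int p * v"
    and F: "F k p = char_quad k ^ p + of_nat p * (X ^ p * of_int v + char_quad k * z)"
    by (rule F_cofactor[OF p])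
  let ?I = "ideal2 (char_quad k) (of_nat p)"
  let ?M = "X ^ p * of_int v + char_quad k * z"
  have "\<not> int p dvd v"
  proof
    assume "int p dvd v"
    then have "(int p)\<^sup>2 dvd V k p - k" unfolding v power2_eq_square by (intro mult_dvd_mono) auto
    then show False using V by (simp add: cong_iff_dvd_diff)
  qed
  then have "coprime (int p) v" using p(1) by (intro prime_imp_coprime) auto
  then have "gcd v (int p) = 1" by (metis coprime_imp_gcd_eq_1 gcd.commute)
  then obtain a b where ab: "a * v + b * int p = 1" using bezout_int[of v "int p"] by auto
  define Y where "Y = (X - of_int k) ^ p"
  have 1: "(X ^ p * Y - 1) * of_int (a * v) \<in> ?I" unfolding Y_def by (rule ideal2_mult[OF X_inverse])
  have 2: "char_quad k * (z * (of_int a * Y)) - of_nat p * of_int b \<in> ?I"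
    by (rule ideal2_diff[OF ideal2_dvd_left[OF dvd_triv_left] ideal2_dvd_right[OF dvd_triv_left]])
  have one: "1 = of_int (a * v) + of_nat p * (of_int b :: int poly)"
  proof -
    have "(1 :: int poly) = of_int (a * v + b * int p)" by (simp only: ab) simp
    then show ?thesis by (simp add: mult.commute)
  qed
  define s where "s = char_quad k"
  have "(of_int a * Y) * ?M - 1
    = (X ^ p * Y - 1) * of_int (a * v) + (char_quad k * (z * (of_int a * Y)) - of_nat p * of_int b)"
    unfolding s_def[symmetric] by (subst one) (simp add: algebra_simps)
  then have M: "(of_int a * Y) * ?M - 1 \<in> ?I" using ideal2_add[OF 1 2] by metis
  obtain N where N: "is_period k (int p) N" "\<not> p dvd N" by (rule ex_is_period_coprime[OF p(1) ram])
  show ?thesis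
    by (rule dedekind_order[OF p(1) F M is_period_power_mem[OF N(1)] N(2) prime_gt_0_nat[OF p(1)] g])
qed

text \<open>If $p^2 \mid V_p - k$, then $s(\theta)^{p-1}/p$, where $s = x^2 - kx - 1$, is an integral
  element outside of $\mathbb{Z}[\theta]$: it is a root of a monic quadratic over $\mathbb{Z}[\theta]$.\<close>
lemma F_not_monogenic:
  assumes ord: "\<And>\<theta>. ev \<theta> (F k p) = 0 \<Longrightarrow> monogenic_order \<theta> (F k p)"
    and root: "\<exists>\<theta>. ev \<theta> (F k p) = 0"
    and p: "prime p" "odd p" and V: "[V k p = k] (mod (int p)\<^sup>2)"
  shows "\<not> monogenic (F k p)"
proof
  assume mon: "monogenic (F k p)"
  obtain \<theta> where \<theta>: "ev \<theta> (F k p) = 0" using root by blast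
  interpret monogenic_order \<theta> "F k p" by (rule ord[OF \<theta>])
  have p0: "p > 0" using p(1) by (rule prime_gt_0_nat)
  obtain v z where v: "V k p - k = int p * v"
    and F: "F k p = char_quad k ^ p + of_nat p * (X ^ p * of_int v + char_quad k * z)"
    by (rule F_cofactor[OF p])
  have "int p * int p dvd int p * v" using V unfolding v[symmetric] by (simp add: cong_iff_dvd_diff power2_eq_square)
  then obtain v' where v': "v = int p * v'" using p0 by auto
  define s where "s = char_quad k"
  define w where "w = X ^ p * of_int v'"
  have F': "F k p = s ^ p + of_nat p * (of_nat p * w + s * z)"
    unfolding F s_def w_def v' by (simp add: mult_ac)
  obtain r where r: "p = Suc (Suc r)" using prime_ge_2_nat[OF p(1)] by (metis add_2_eq_Suc le_Suc_ex)
  have q0: "(of_nat p :: complex) \<noteq> 0" using p0 by simp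
  define y where "y = ev \<theta> s ^ (p - 1) / of_nat p"
  have sp: "ev \<theta> s ^ p = - (of_nat p * (of_nat p * ev \<theta> w + ev \<theta> s * ev \<theta> z))"
    using \<theta> unfolding F' by (simp add: eq_neg_iff_add_eq_0)
  \<comment> \<open>Here r = p - 2, so s^(2p-2) = s^r s^p. Substituting s^p = -p (p w + s z) cancels
    p^2 in the first term and leaves one factor y in the second.\<close>
  have "y * y = ev \<theta> s ^ r * ev \<theta> s ^ p / (of_nat p * of_nat p)"
    by (simp add: y_def r mult_ac)
  also have "\<dots> = - (ev \<theta> z * y) - ev \<theta> s ^ r * ev \<theta> w"
    unfolding sp y_def using q0 by (simp add: field_simps r del: of_nat_Suc)
  also have "\<dots> = ev \<theta> (- z) * y + ev \<theta> (- (s ^ r * w))" by simp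
  finally have "algebraic_int y" by (rule algebraic_int_quadratic)
  moreover have "y \<in> num_field \<theta>"
  proof -
    interpret rh: map_poly_comm_ring_hom "of_rat :: rat \<Rightarrow> complex" ..
    have "y = ev \<theta> (s ^ (p - 1)) / of_nat p" by (simp add: y_def)
    also have "\<dots> = poly (map_poly of_rat (Polynomial.smult (1 / of_nat p) (map_poly rat_of_int (s ^ (p - 1))))) \<theta>"
      by (simp add: ev_def of_rat_hom.map_poly_hom_smult map_poly_map_poly o_def of_rat_divide)
    finally show ?thesis unfolding num_field_def by blast
  qed
  ultimately have "y \<in> ring_of_integers \<theta>" by (simp add: ring_of_integers_def)
  then have "y \<in> range (ev \<theta>)"
    using mon \<theta> unfolding monogenic_def range_ev_eq ev_def by blast
  then obtain h0 where "y = ev \<theta> h0" by blast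
  then obtain h where h: "degree h < degree (F k p)" "y = ev \<theta> h" using ev_reduce[of h0] by metis
  have "ev \<theta> s ^ (p - 1) = of_nat p * ev \<theta> h"
    using q0 unfolding h(2)[symmetric] y_def by simp
  then have "ev \<theta> (s ^ (p - 1) - of_nat p * h) = 0" by simp
  then have dvd: "F k p dvd s ^ (p - 1) - of_nat p * h" using ev_eq_0_iff by blast
  have s: "lead_coeff s = 1" "degree s = 2" unfolding s_def char_quad_eq by simp_all
  then have s0: "s \<noteq> 0" by auto
  have ds: "degree (s ^ (p - 1)) = 2 * (p - 1)" using s by (simp add: degree_power_eq[OF s0])
  \<comment> \<open>If y = h(\<theta>) with h reduced, then s^(p-1) - p h is a multiple of F of
    degree below 2p, hence 0; but s^(p-1) is monic and not divisible by p.\<close>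
  have "degree (s ^ (p - 1) - of_nat p * h) < degree (F k p)"
  proof (rule degree_diff_less)
    show "degree (s ^ (p - 1)) < degree (F k p)" using ds degree_F(1)[OF p0] p0 by simp
    show "degree (of_nat p * h) < degree (F k p)"
      using h(1) degree_mult_le[of "of_nat p" h] by (simp add: of_nat_poly)
  qed
  then have "s ^ (p - 1) - of_nat p * h = 0" using dvd dvd_imp_degree_le by (metis leD)
  then have "s ^ (p - 1) = of_nat p * h" by simp
  then have "lead_coeff (s ^ (p - 1)) = int p * lead_coeff h" by (simp add: lead_coeff_mult of_nat_poly)
  then have "1 = int p * lead_coeff h" using s(1) by (simp add: lead_coeff_power)
  then have "int p dvd 1" by (rule dvdI)
  then show False using p(1) by auto
qed

theorem theorem1p1:
  fixes p :: nat and k :: int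
  assumes "prime p"
    and "k \<ge> 1"
    and "\<not> [k = 0] (mod 4)"
    and "squarefree ((k^2 + 4) div (gcd 2 k)^2)"
  shows "(wall_sun_sun k p \<longleftrightarrow> non_monogenic (F k p))
         \<and> (int p dvd k^2 + 4 \<longrightarrow> monogenic (F k p))"
proof -
  note p = assms(1) and sqf = assms(4)
  have k4: "\<not> 4 dvd k" using assms(3) by (simp add: cong_0_iff)
  note ord = F_monogenic_order[OF p assms(2) k4 sqf]
  have ann: "monic_annihilator \<theta> (F k p)" if "ev \<theta> (F k p) = 0" for \<theta>
    using ord[OF that] by (simp add: monogenic_order_def)
  have irred: "monic_irred (F k p)" by (rule monic_irred_F[OF p assms(2) k4 sqf])
  \<comment> \<open>Primes other than p never obstruct, so maximality at p alone decides.\<close>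
  have mono: "monogenic (F k p)"
    if at_p: "\<And>\<theta> g. ev \<theta> (F k p) = 0 \<Longrightarrow> almost_integral \<theta> (ev \<theta> g / of_nat p) \<Longrightarrow>
      ev \<theta> g / of_nat p \<in> range (ev \<theta>)"
  proof (rule monogenicI[OF irred ord])
    fix \<theta> q g
    assume \<theta>: "ev \<theta> (F k p) = 0" and q: "prime q" and g: "almost_integral \<theta> (ev \<theta> g / of_nat q)"
    show "ev \<theta> g / of_nat q \<in> range (ev \<theta>)"
      using at_p[OF \<theta>] g F_maximal_unramified[OF ann[OF \<theta>] p q _ _ g]
        F_maximal_ramified[OF ann[OF \<theta>] p q _ _ k4 sqf g] by blast
  qed
  have ramified: "monogenic (F k p)" if "int p dvd k\<^sup>2 + 4"
    using mono F_maximal_self_ramified[OF ann p that k4 sqf] by blast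
  show ?thesis
  proof (cases "int p dvd k\<^sup>2 + 4 \<or> even p")
    case True
    \<comment> \<open>For these p the equivalence holds because both of its sides are false.\<close>
    have "\<not> wall_sun_sun k p \<and> monogenic (F k p)"
    proof (cases "even p")
      case True
      then have p2: "p = 2" using primes_dvd_imp_eq[OF two_is_prime_nat p] by simp
      have "monogenic (F k p)"
      proof (cases "even k")
        case True
        then show ?thesis by (intro ramified) (simp add: p2)
      next
        case False
        then show ?thesis using mono F_maximal_self_unramified_2[of _ k] ann unfolding p2 by blast
      qed
      then show ?thesis using not_wall_sun_sun_2[OF k4] p2 by simp
    next
      case False
      then show ?thesis using True ramified not_wall_sun_sun_ramified[OF p] by blast
    qed
    then show ?thesis by (simp add: non_monogenic_def)
  next
    case False
    then have odd: "odd p" and ram: "\<not> int p dvd k\<^sup>2 + 4" by auto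
    have "monogenic (F k p) \<longleftrightarrow> \<not> [V k p = k] (mod (int p)\<^sup>2)"
    proof
      show "\<not> [V k p = k] (mod (int p)\<^sup>2)" if "monogenic (F k p)"
        using F_not_monogenic[OF ord ex_root_F[OF p assms(2) k4 sqf] p odd] that by blast
      show "monogenic (F k p)" if "\<not> [V k p = k] (mod (int p)\<^sup>2)"
        using mono F_maximal_self_unramified_odd[OF ann p odd ram that] by blast
    qed
    then show ?thesis
      using wall_sun_sun_iff_V[OF p odd ram V_prime_cong[OF p odd]] irred ram
      by (simp add: non_monogenic_def)
  qed
qed

end
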